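(* Let $k$ and $n$ be integers such that $n \ge k \ge 10$, and let $\varepsilon = k \bmod 2$. Then $$ar_{\mathcal{P}}(n, P_k) \ge \begin{cases} n + 2k - 12 & \text{if } k \le n < 3\lfloor k/2 \rfloor + \varepsilon - 5, \\[2mm] \left(3n + 9\lfloor k/2 \rfloor + 3\varepsilon - 43\right)/2 & \text{if } 3\lfloor k/2 \rfloor + \varepsilon - 5 \le n \le 5\lfloor k/2 \rfloor + \varepsilon - 15, \\[2mm] 2n + k - 14 & \text{if } n > 5\lfloor k/2 \rfloor + \varepsilon - 15. \end{cases}$$
   Context: All graphs are finite and simple. $P_k$ is the path on $k$ vertices. For positive integers $a,b$, $a \bmod b$ is the remainder when $a$ is divided by $b$. A plane triangulation is a plane graph in which every face (including the outer face) is bounded by a triangle. For a planar graph $H$ and $n \ge |H|$ (where $|H|$ is the number of vertices of $H$), $\mathcal{T}_n(H)$ is the family of all plane triangulations on $n$ vertices that contain a (not necessarily induced) subgraph isomorphic to $H$. Edge-colorings are arbitrary (not necessarily proper). A subgraph of an edge-colored graph is rainbow if all its edges have different colors. The planar anti-Ramsey number $ar_{\mathcal{P}}(n,H)$ is the maximum number of colors used in an edge-coloring of a plane triangulation $T \in \mathcal{T}_n(H)$ such that $T$ contains no rainbow copy of $H$ (the maximum is over all $T\in\mathcal{T}_n(H)$ and all such colorings of $T$). *)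

theory Defs
  imports "HOL-Analysis.Analysis"
begin

section \<open>Finite simple graphs\<close>

text \<open>A graph is a pair of a vertex set and a set of edges, each edge being the set of its two
  ends.\<close>

type_synonym 'a graph = "'a set \<times> 'a set set"

abbreviation verts :: "'a graph \<Rightarrow> 'a set" where "verts G \<equiv> fst G"

abbreviation edges :: "'a graph \<Rightarrow> 'a set set" where "edges G \<equiv> snd G"

definition simple_graph :: "'a graph \<Rightarrow> bool" where
  "simple_graph G \<longleftrightarrow>
     finite (verts G) \<and> (\<forall>e\<in>edges G. e \<subseteq> verts G \<and> card e = 2)"

definition subgraph :: "'a graph \<Rightarrow> 'a graph \<Rightarrow> bool" where
  "subgraph H G \<longleftrightarrow> simple_graph H \<and> verts H \<subseteq> verts G \<and> edges H \<subseteq> edges G"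

definition isomorphic :: "'a graph \<Rightarrow> 'b graph \<Rightarrow> bool" where
  "isomorphic G H \<longleftrightarrow>
     (\<exists>f. bij_betw f (verts G) (verts H) \<and>
          (\<forall>u\<in>verts G. \<forall>v\<in>verts G. {u, v} \<in> edges G \<longleftrightarrow> {f u, f v} \<in> edges H))"

definition path_graph :: "nat \<Rightarrow> nat graph" where
  "path_graph k = ({0..<k}, {{i, Suc i} | i. Suc i < k})"


section \<open>Plane triangulations\<close>

text \<open>A plane graph is a simple graph whose vertices are points of the plane, together with a map
  \<open>\<gamma>\<close> that draws every edge as an arc between its two ends.  The interior of an edge contains no
  vertex and no point of any other edge.  The values of \<open>\<gamma>\<close> off the edge set are irrelevant.\<close>

type_synonym drawing = "complex set \<Rightarrow> real \<Rightarrow> complex"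

definition plane_graph :: "complex graph \<Rightarrow> drawing \<Rightarrow> bool" where
  "plane_graph G \<gamma> \<longleftrightarrow>
     simple_graph G \<and>
     (\<forall>e\<in>edges G. arc (\<gamma> e) \<and> {pathstart (\<gamma> e), pathfinish (\<gamma> e)} = e \<and>
        (path_image (\<gamma> e) - e) \<inter> verts G = {}) \<and>
     (\<forall>e\<in>edges G. \<forall>e'\<in>edges G. e \<noteq> e' \<longrightarrow>
        (path_image (\<gamma> e) - e) \<inter> path_image (\<gamma> e') = {})"

definition point_set :: "complex graph \<Rightarrow> drawing \<Rightarrow> complex set" where
  "point_set G \<gamma> = verts G \<union> (\<Union>e\<in>edges G. path_image (\<gamma> e))"

text \<open>The unbounded component, i.e. the outer face, is included.\<close>

definition faces :: "complex graph \<Rightarrow> drawing \<Rightarrow> complex set set" where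
  "faces G \<gamma> = components (- point_set G \<gamma>)"

definition bounded_by_triangle :: "complex graph \<Rightarrow> drawing \<Rightarrow> complex set \<Rightarrow> bool" where
  "bounded_by_triangle G \<gamma> F \<longleftrightarrow>
     (\<exists>u v w. u \<noteq> v \<and> v \<noteq> w \<and> u \<noteq> w \<and> {{u, v}, {v, w}, {u, w}} \<subseteq> edges G \<and>
        frontier F = (\<Union>e\<in>{{u, v}, {v, w}, {u, w}}. path_image (\<gamma> e)))"

definition plane_triangulation :: "complex graph \<Rightarrow> drawing \<Rightarrow> bool" where
  "plane_triangulation G \<gamma> \<longleftrightarrow>
     plane_graph G \<gamma> \<and> (\<forall>F\<in>faces G \<gamma>. bounded_by_triangle G \<gamma> F)"

definition triangulations_containing :: "nat \<Rightarrow> 'b graph \<Rightarrow> (complex graph \<times> drawing) set" where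
  "triangulations_containing n H =
     {(G, \<gamma>). plane_triangulation G \<gamma> \<and> card (verts G) = n \<and>
        (\<exists>H'. subgraph H' G \<and> isomorphic H' H)}"


section \<open>Planar anti-Ramsey numbers\<close>

text \<open>An edge-coloring is an arbitrary function on edges; its number of colors is the number of
  values it takes on the edge set.\<close>

definition rainbow :: "('a set \<Rightarrow> nat) \<Rightarrow> 'a graph \<Rightarrow> bool" where
  "rainbow c H \<longleftrightarrow> inj_on c (edges H)"

definition color_numbers :: "nat \<Rightarrow> 'b graph \<Rightarrow> nat set" where
  "color_numbers n H =
     {card (c ` edges G) | G \<gamma> c.
        (G, \<gamma>) \<in> triangulations_containing n H \<and>
        \<not> (\<exists>H'. subgraph H' G \<and> isomorphic H' H \<and> rainbow c H')}"

definition planar_anti_ramsey :: "nat \<Rightarrow> 'b graph \<Rightarrow> nat" where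
  "planar_anti_ramsey n H = Max (color_numbers n H)"

lemma finite_color_numbers: "finite (color_numbers n H)"
proof (rule finite_subset)
  show "color_numbers n H \<subseteq> {..2 ^ n}"
  proof
    fix m assume "m \<in> color_numbers n H"
    then obtain G :: "complex graph" and \<gamma> and c :: "complex set \<Rightarrow> nat" where
      m: "m = card (c ` edges G)" and "(G, \<gamma>) \<in> triangulations_containing n H"
      unfolding color_numbers_def by blast
    then have fin: "finite (verts G)" and n: "card (verts G) = n"
      and sub: "edges G \<subseteq> Pow (verts G)"
      by (auto simp: triangulations_containing_def plane_triangulation_def plane_graph_def
          simple_graph_def)
    have "m \<le> card (edges G)"
      unfolding m using fin sub by (meson card_image_le finite_Pow_iff finite_subset)
    also have "\<dots> \<le> card (Pow (verts G))"
      using fin sub by (intro card_mono) auto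
    finally show "m \<in> {..2 ^ n}" using fin n by (simp add: card_Pow)
  qed
qed simp

end

theory Submission
  imports Defs
begin

text \<open>All triangulations used here are stacked: starting from a triangle, a new vertex is repeatedly put
  inside a bounded face and joined to its three corners. Such a graph has a straight-line drawing,
  because a point in the interior of a triangle cuts it into three triangles. Take two adjacent hubs,
  both joined to every vertex of a path \<open>w\<^sub>0, \<dots>, w\<^sub>N\<close> (the spine), and stack further
  vertices (tips) into some of the faces spanned by a hub and a spine edge. Write \<open>t = k div 2\<close>.

  For \<open>n < 3t + \<epsilon> - 5\<close> use \<open>n - k + 3\<close> tips and give the three edges at each tip one
  colour of their own, all other edges having distinct colours. A rainbow path cannot pass through a
  tip, so it contains at most two of them and has at most \<open>k - 1\<close> vertices.

  For larger \<open>n\<close> let the core consist of the hubs and \<open>w\<^sub>1, \<dots>, w\<^sub>s\<close> with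
  \<open>s = t - 4\<close>, and stack a tip into every face spanned by a hub and an edge of
  \<open>w\<^sub>1 \<dots> w\<^sub>s\<close>. All edges missing the core get the same colour, the other edges get
  distinct colours. A rainbow path then has at most one edge off the core, hence at most
  \<open>2 (s + 2) + 2 = 2t - 2\<close> vertices, while the number of colours is \<open>2n + 3s - 3\<close>. This
  covers both remaining ranges.\<close>

section \<open>Subdividing a triangle\<close>

text \<open>The difference of the two coefficient triples sums to zero and annihilates the corners,
  so a nonzero difference would be an affine dependence.\<close>

lemma barycentric_unique:
  fixes a b c :: "'a::real_vector" and x y z x' y' z' :: real
  assumes "\<not> affine_dependent {a, b, c}" "a \<noteq> b" "a \<noteq> c" "b \<noteq> c"
    and "x + y + z = x' + y' + z'"
    and "x *\<^sub>R a + y *\<^sub>R b + z *\<^sub>R c = x' *\<^sub>R a + y' *\<^sub>R b + z' *\<^sub>R c"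
  shows "x = x' \<and> y = y' \<and> z = z'"
proof (rule ccontr)
  assume neq: "\<not> ?thesis"
  define U where "U = (\<lambda>v. if v = a then x - x' else if v = b then y - y' else z - z')"
  have "affine_dependent {a, b, c}"
    unfolding affine_dependent_explicit_finite[OF finite.insertI[OF finite.insertI[OF finite.insertI[OF finite.emptyI]]]]
  proof (intro exI conjI)
    show "sum U {a, b, c} = 0"
      using assms by (simp add: U_def)
    show "\<exists>v\<in>{a, b, c}. U v \<noteq> 0"
      using assms neq by (auto simp: U_def)
    show "(\<Sum>v\<in>{a, b, c}. U v *\<^sub>R v) = 0"
      using assms by (simp add: U_def algebra_simps)
  qed
  with assms show False by simp
qed

lemma interior_triangle_iff:
  fixes a b c :: complex
  assumes "\<not> collinear {a, b, c}"
  shows "v \<in> interior (convex hull {a, b, c}) \<longleftrightarrow>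
    (\<exists>x y z. 0 < x \<and> 0 < y \<and> 0 < z \<and> x + y + z = 1 \<and> v = x *\<^sub>R a + y *\<^sub>R b + z *\<^sub>R c)"
  using interior_convex_hull_3_minimal[OF assms] by auto

lemma not_collinear_3D:
  assumes "\<not> collinear {a, b, c}"
  shows "\<not> affine_dependent {a, b, c}" "a \<noteq> b" "a \<noteq> c" "b \<noteq> c"
  using assms collinear_3_eq_affine_dependent by blast+

text \<open>An interior point has a positive \<open>c\<close>-coordinate, whereas every point of the
  line through \<open>a\<close> and \<open>b\<close> has \<open>c\<close>-coordinate 0. This makes
  the triangles around \<open>p\<close> nondegenerate.\<close>

lemma not_collinear_interior_point:
  fixes a b c p :: complex
  assumes nc: "\<not> collinear {a, b, c}" and p: "p \<in> interior (convex hull {a, b, c})"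
  shows "\<not> collinear {p, a, b}"
proof
  assume col: "collinear {p, a, b}"
  note nc' = not_collinear_3D[OF nc]
  obtain x y z where xyz: "0 < x" "0 < y" "0 < z" "x + y + z = 1"
    "p = x *\<^sub>R a + y *\<^sub>R b + z *\<^sub>R c"
    using p interior_triangle_iff[OF nc] by blast
  have "p \<in> affine hull {a, b}"
    using col nc'(2) by (metis collinear_3_affine_hull insert_commute)
  then obtain u v where uv: "u + v = 1" "p = u *\<^sub>R a + v *\<^sub>R b"
    by (auto simp: affine_hull_2)
  have "x = u \<and> y = v \<and> z = 0"
    by (rule barycentric_unique[OF nc']) (use xyz uv in auto)
  with xyz show False by simp
qed

text \<open>Divide each barycentric coordinate of \<open>v\<close> by the corresponding coordinate
  of \<open>p\<close>. Inside the triangle \<open>p a b\<close> the ratio at \<open>c\<close> is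
  strictly smaller than the ratio at \<open>a\<close>; inside \<open>p b c\<close> it is strictly
  larger.\<close>

lemma subtriangles_disjoint:
  fixes a b c p :: complex
  assumes nc: "\<not> collinear {a, b, c}" and p: "p \<in> interior (convex hull {a, b, c})"
  shows "interior (convex hull {p, a, b}) \<inter> interior (convex hull {p, b, c}) = {}"
proof (rule ccontr)
  assume "\<not> ?thesis"
  then obtain v where v: "v \<in> interior (convex hull {p, a, b})" "v \<in> interior (convex hull {p, b, c})"
    by blast
  note nc' = not_collinear_3D[OF nc]
  have nc2: "\<not> collinear {b, c, a}" and p2: "p \<in> interior (convex hull {b, c, a})"
    using nc p by (simp_all add: insert_commute)
  obtain x y z where p: "0 < x" "0 < y" "0 < z" "x + y + z = 1"
    "p = x *\<^sub>R a + y *\<^sub>R b + z *\<^sub>R c"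
    using p interior_triangle_iff[OF nc] by blast
  obtain r s t where r: "0 < r" "0 < s" "0 < t" "r + s + t = 1"
    "v = r *\<^sub>R p + s *\<^sub>R a + t *\<^sub>R b"
    using v(1) interior_triangle_iff[OF not_collinear_interior_point[OF nc assms(2)]] by blast
  obtain r' s' t' where r': "0 < r'" "0 < s'" "0 < t'" "r' + s' + t' = 1"
    "v = r' *\<^sub>R p + s' *\<^sub>R b + t' *\<^sub>R c"
    using v(2) interior_triangle_iff[OF not_collinear_interior_point[OF nc2 p2]] by blast
  have "r * x + s = r' * x \<and> r * y + t = r' * y + s' \<and> r * z = r' * z + t'"
  proof (rule barycentric_unique[OF nc'])
    have "r * x + s + (r * y + t) + r * z = r * (x + y + z) + s + t"
      by (simp add: algebra_simps)
    also have "\<dots> = r' * (x + y + z) + s' + t'" using p r r' by simp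
    finally show "r * x + s + (r * y + t) + r * z = r' * x + (r' * y + s') + (r' * z + t')"
      by (simp add: algebra_simps)
    have "v = (r * x + s) *\<^sub>R a + (r * y + t) *\<^sub>R b + (r * z) *\<^sub>R c"
      unfolding r(5) p(5) by (simp add: algebra_simps)
    moreover have "v = (r' * x) *\<^sub>R a + (r' * y + s') *\<^sub>R b + (r' * z + t') *\<^sub>R c"
      unfolding r'(5) p(5) by (simp add: algebra_simps)
    ultimately show "(r * x + s) *\<^sub>R a + (r * y + t) *\<^sub>R b + (r * z) *\<^sub>R c =
       (r' * x) *\<^sub>R a + (r' * y + s') *\<^sub>R b + (r' * z + t') *\<^sub>R c" by simp
  qed
  then have "r * x < r' * x" "r' * z < r * z" using r r' by linarith+
  then show False using p by simp
qed

text \<open>The same ratios decide: on the segment from \<open>p\<close> to \<open>c\<close> the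
  ratio at \<open>c\<close> is at least the one at \<open>a\<close>, but inside \<open>p a b\<close>
  it is strictly smaller.\<close>

lemma subtriangle_disjoint_segment:
  fixes a b c p :: complex
  assumes nc: "\<not> collinear {a, b, c}" and p: "p \<in> interior (convex hull {a, b, c})"
  shows "interior (convex hull {p, a, b}) \<inter> closed_segment p c = {}"
proof (rule ccontr)
  assume "\<not> ?thesis"
  then obtain v where v: "v \<in> interior (convex hull {p, a, b})" "v \<in> closed_segment p c"
    by blast
  note nc' = not_collinear_3D[OF nc]
  obtain x y z where p: "0 < x" "0 < y" "0 < z" "x + y + z = 1"
    "p = x *\<^sub>R a + y *\<^sub>R b + z *\<^sub>R c"
    using p interior_triangle_iff[OF nc] by blast
  obtain r s t where r: "0 < r" "0 < s" "0 < t" "r + s + t = 1"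
    "v = r *\<^sub>R p + s *\<^sub>R a + t *\<^sub>R b"
    using v(1) interior_triangle_iff[OF not_collinear_interior_point[OF nc assms(2)]] by blast
  obtain u where u: "0 \<le> u" "v = (1 - u) *\<^sub>R p + u *\<^sub>R c"
    using v(2) by (auto simp: in_segment)
  have "r * x + s = (1 - u) * x \<and> r * y + t = (1 - u) * y \<and> r * z = (1 - u) * z + u"
  proof (rule barycentric_unique[OF nc'])
    have "r * x + s + (r * y + t) + r * z = r * (x + y + z) + s + t"
      by (simp add: algebra_simps)
    also have "\<dots> = (1 - u) * (x + y + z) + u" using p r by simp
    finally show "r * x + s + (r * y + t) + r * z = (1 - u) * x + (1 - u) * y + ((1 - u) * z + u)"
      by (simp add: algebra_simps)
    have "v = (r * x + s) *\<^sub>R a + (r * y + t) *\<^sub>R b + (r * z) *\<^sub>R c"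
      unfolding r(5) p(5) by (simp add: algebra_simps)
    moreover have "v = ((1 - u) * x) *\<^sub>R a + ((1 - u) * y) *\<^sub>R b + ((1 - u) * z + u) *\<^sub>R c"
      unfolding u(2) p(5) by (simp add: algebra_simps)
    ultimately show "(r * x + s) *\<^sub>R a + (r * y + t) *\<^sub>R b + (r * z) *\<^sub>R c =
       ((1 - u) * x) *\<^sub>R a + ((1 - u) * y) *\<^sub>R b + ((1 - u) * z + u) *\<^sub>R c" by simp
  qed
  then have "r * x < (1 - u) * x" "(1 - u) * z \<le> r * z" using r u by linarith+
  then show False using p by simp
qed

text \<open>Subtract from \<open>v\<close> the multiple of \<open>p\<close> that cancels its
  \<open>c\<close>-coordinate. Since the ratio at \<open>c\<close> is the least, the remaining
  coefficients of \<open>a\<close> and \<open>b\<close> stay nonnegative.\<close>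

lemma minimal_ratio_in_subtriangle:
  fixes a b c p :: complex
  assumes nc: "\<not> collinear {a, b, c}" and p: "p \<in> interior (convex hull {a, b, c})"
    and pxyz: "0 < x" "0 < y" "0 < z" "p = x *\<^sub>R a + y *\<^sub>R b + z *\<^sub>R c" "x + y + z = 1"
    and v: "0 < x'" "0 < y'" "0 < z'" "v = x' *\<^sub>R a + y' *\<^sub>R b + z' *\<^sub>R c" "x' + y' + z' = 1"
    and min: "z' / z \<le> x' / x" "z' / z \<le> y' / y"
  shows "v \<in> interior (convex hull {p, a, b}) \<union> closed_segment p a \<union> closed_segment p b"
proof -
  define r where "r = z' / z"
  define s where "s = x' - r * x"
  define t where "t = y' - r * y"
  have r: "0 < r" "r * z = z'" using v pxyz by (auto simp: r_def)
  have s: "0 \<le> s" using min(1) pxyz by (auto simp: s_def r_def field_simps)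
  have t: "0 \<le> t" using min(2) pxyz by (auto simp: t_def r_def field_simps)
  have "r + s + t = r * (x + y + z) + s + t" using pxyz by simp
  also have "\<dots> = x' + y' + z'" using r(2) by (simp add: s_def t_def algebra_simps)
  finally have sum: "r + s + t = 1" using v by simp
  have "v = (r * x + s) *\<^sub>R a + (r * y + t) *\<^sub>R b + (r * z) *\<^sub>R c"
    using v r by (simp add: s_def t_def)
  then have veq: "v = r *\<^sub>R p + s *\<^sub>R a + t *\<^sub>R b"
    unfolding pxyz(4) by (simp add: algebra_simps)
  \<comment> \<open>A vanishing coefficient means that \<open>v\<close> lies on a new segment at
    \<open>p\<close> rather than in the open subtriangle.\<close>
  consider "0 < s" "0 < t" | "s = 0" | "t = 0" using s t by linarith
  then show ?thesis
  proof cases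
    case 1
    then show ?thesis
      using interior_triangle_iff[OF not_collinear_interior_point[OF nc p]] r sum veq by blast
  next
    case 2
    then have "r = 1 - t" using sum by simp
    then have "v \<in> closed_segment p b"
      using 2 r sum veq t by (auto simp: in_segment intro!: exI[of _ t])
    then show ?thesis by simp
  next
    case 3
    then have "r = 1 - s" using sum by simp
    then have "v \<in> closed_segment p a"
      using 3 r sum veq s by (auto simp: in_segment intro!: exI[of _ s])
    then show ?thesis by simp
  qed
qed

text \<open>The cases are the corner at which the ratio of the coordinates of \<open>v\<close> to
  those of \<open>p\<close> is least; \<open>v\<close> belongs to the subtriangle opposite that
  corner.\<close>

lemma interior_triangle_subdivision:
  fixes a b c p :: complex
  assumes nc: "\<not> collinear {a, b, c}" and p: "p \<in> interior (convex hull {a, b, c})"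
  shows "interior (convex hull {a, b, c}) \<subseteq>
    interior (convex hull {p, a, b}) \<union> interior (convex hull {p, b, c}) \<union>
    interior (convex hull {p, a, c}) \<union>
    (closed_segment p a \<union> closed_segment p b \<union> closed_segment p c)"
proof
  fix v assume "v \<in> interior (convex hull {a, b, c})"
  then obtain x' y' z' where v: "0 < x'" "0 < y'" "0 < z'" "x' + y' + z' = 1"
    "v = x' *\<^sub>R a + y' *\<^sub>R b + z' *\<^sub>R c"
    using interior_triangle_iff[OF nc] by blast
  obtain x y z where pxyz: "0 < x" "0 < y" "0 < z" "x + y + z = 1"
    "p = x *\<^sub>R a + y *\<^sub>R b + z *\<^sub>R c"
    using p interior_triangle_iff[OF nc] by blast
  have perm: "{b, c, a} = {a, b, c}" "{a, c, b} = {a, b, c}" by auto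
  consider "z' / z \<le> x' / x" "z' / z \<le> y' / y" | "x' / x \<le> y' / y" "x' / x \<le> z' / z"
    | "y' / y \<le> x' / x" "y' / y \<le> z' / z" by linarith
  then show "v \<in> interior (convex hull {p, a, b}) \<union> interior (convex hull {p, b, c}) \<union>
    interior (convex hull {p, a, c}) \<union>
    (closed_segment p a \<union> closed_segment p b \<union> closed_segment p c)"
  proof cases
    case 1
    show ?thesis
      using minimal_ratio_in_subtriangle[of a b c p x y z x' y' z' v] nc p pxyz v 1 by auto
  next
    case 2
    show ?thesis
      using minimal_ratio_in_subtriangle[of b c a p y z x y' z' x' v, unfolded perm] nc p pxyz v 2
      by (auto simp: algebra_simps)
  next
    case 3
    show ?thesis
      using minimal_ratio_in_subtriangle[of a c b p x z y x' z' y' v, unfolded perm] nc p pxyz v 3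
      by (auto simp: algebra_simps)
  qed
qed

section \<open>Straight-line triangulations\<close>

text \<open>\<open>T\<close> is the set of bounded faces, each given by its corners, and \<open>t0\<close> the outer triangle.\<close>

locale straight_triangulation =
  fixes V :: "complex set" and E T :: "complex set set" and t0 :: "complex set"
  assumes finite_vertices: "finite V"
    and edge: "e \<in> E \<Longrightarrow> e \<subseteq> V \<and> card e = 2 \<and> (convex hull e - e) \<inter> V = {}"
    and edges_disjoint: "\<lbrakk>e \<in> E; e' \<in> E; e \<noteq> e'\<rbrakk> \<Longrightarrow> (convex hull e - e) \<inter> convex hull e' = {}"
    and triangle: "t \<in> insert t0 T \<Longrightarrow> \<exists>a b c. t = {a, b, c} \<and> \<not> collinear {a, b, c} \<and>
      {{a, b}, {b, c}, {a, c}} \<subseteq> E"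
    and interiors_disjoint: "\<lbrakk>t \<in> T; t' \<in> T; t \<noteq> t'\<rbrakk> \<Longrightarrow>
      interior (convex hull t) \<inter> interior (convex hull t') = {}"
    and interior_empty: "t \<in> T \<Longrightarrow> interior (convex hull t) \<inter> (V \<union> (\<Union>e\<in>E. convex hull e)) = {}"
    and cover: "convex hull t0 =
      V \<union> (\<Union>e\<in>E. convex hull e) \<union> (\<Union>t\<in>T. interior (convex hull t))"

text \<open>An edge is an unordered pair while a path needs a start, so an orientation is picked
  arbitrarily; the image does not depend on it.\<close>

definition straight_drawing :: drawing where
  "straight_drawing e = (let p = (SOME p. e = {fst p, snd p}) in linepath (fst p) (snd p))"

lemma straight_drawing_edge:
  assumes "card e = 2"
  shows "arc (straight_drawing e)" "{pathstart (straight_drawing e), pathfinish (straight_drawing e)} = e"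
    "path_image (straight_drawing e) = convex hull e"
proof -
  obtain a b where ab: "e = {a, b}" "a \<noteq> b"
    using assms by (auto simp: card_2_iff)
  define p where "p = (SOME p. e = {fst p, snd p})"
  have p: "e = {fst p, snd p}"
    unfolding p_def by (rule someI[of _ "(a, b)"]) (simp add: ab)
  then have ne: "fst p \<noteq> snd p" using assms by auto
  have eq: "straight_drawing e = linepath (fst p) (snd p)"
    by (simp add: straight_drawing_def p_def Let_def)
  show "arc (straight_drawing e)" using ne by (simp add: eq)
  show "{pathstart (straight_drawing e), pathfinish (straight_drawing e)} = e"
    unfolding eq by (simp flip: p)
  show "path_image (straight_drawing e) = convex hull e"
    unfolding eq by (simp add: segment_convex_hull flip: p)
qed

lemma frontier_triangle:
  "frontier (convex hull {a, b, c::complex}) = (\<Union>e\<in>{{a, b}, {b, c}, {a, c}}. convex hull e)"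
  by (simp add: frontier_of_triangle segment_convex_hull insert_commute Un_ac)

lemma interior_triangle_nonempty:
  fixes a b c :: complex
  assumes "\<not> collinear {a, b, c}"
  shows "interior (convex hull {a, b, c}) \<noteq> {}"
  using interior_triangle_iff[OF assms, of "(1/3) *\<^sub>R a + (1/3) *\<^sub>R b + (1/3) *\<^sub>R c"]
  by (auto intro!: exI[of _ "1/3"])

text \<open>The point is to identify the faces. The open triangles of \<open>T\<close> and the
  complement of the outer triangle are nonempty, open, connected and pairwise disjoint, and by
  \<open>cover\<close> they fill the complement of the drawing. Such a partition is the set of
  components.\<close>

lemma straight_triangulation_plane:
  assumes "straight_triangulation V E T t0"
  shows "plane_triangulation (V, E) straight_drawing"
proof -
  interpret straight_triangulation V E T t0 by fact
  have c2: "card e = 2" if "e \<in> E" for e using edge that by blast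
  note sd = straight_drawing_edge[OF c2]
  have ps: "point_set (V, E) straight_drawing = V \<union> (\<Union>e\<in>E. convex hull e)"
    by (simp add: point_set_def sd)
  let ?F = "insert (- (convex hull t0)) ((\<lambda>t. interior (convex hull t)) ` T)"
  have hull: "convex hull t0 = point_set (V, E) straight_drawing \<union> (\<Union>t\<in>T. interior (convex hull t))"
    unfolding ps by (rule cover)
  have disj: "interior (convex hull t) \<inter> point_set (V, E) straight_drawing = {}" if "t \<in> T" for t
    unfolding ps using that by (rule interior_empty)
  have "finite t0" using triangle[of t0] by blast
  then have compact: "compact (convex hull t0)"
    by (intro compact_convex_hull finite_imp_compact)
  then have bdd: "bounded (convex hull t0)" by (rule compact_imp_bounded)
  have compl: "- (convex hull t0) \<noteq> {}"
  proof
    assume "- (convex hull t0) = {}"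
    then have "convex hull t0 = UNIV" by auto
    then show False using bdd not_bounded_UNIV by metis
  qed
  have "components (- point_set (V, E) straight_drawing) = ?F"
  proof (rule components_open_unique)
    have "- (convex hull t0) \<inter> interior (convex hull t) = {}" if "t \<in> T" for t
      using hull that by blast
    then show "pairwise disjnt ?F"
      using interiors_disjoint by (fastforce simp: pairwise_def disjnt_def)
    show "\<Union> ?F = - point_set (V, E) straight_drawing"
      using hull disj by auto
    show "open X \<and> connected X \<and> X \<noteq> {}" if X: "X \<in> ?F" for X
    proof (cases "X = - (convex hull t0)")
      case True
      have "open X"
        unfolding True by (rule open_Compl[OF compact_imp_closed[OF compact]])
      moreover have "connected X"
        unfolding True by (rule connected_complement_bounded_convex[OF bdd]) auto
      ultimately show ?thesis using compl True by simp
    next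
      case False
      then obtain t where t: "t \<in> T" "X = interior (convex hull t)" using X by blast
      obtain a b c where "t = {a, b, c}" "\<not> collinear {a, b, c}" using triangle[of t] t(1) by auto
      then have "X \<noteq> {}" using interior_triangle_nonempty t(2) by simp
      moreover have "connected X"
        unfolding t(2) by (intro convex_connected convex_interior convex_convex_hull)
      ultimately show ?thesis using t(2) by simp
    qed
  qed
  then have faces: "faces (V, E) straight_drawing = ?F"
    by (simp add: faces_def)
  have "plane_graph (V, E) straight_drawing"
    unfolding plane_graph_def simple_graph_def
    using finite_vertices edge edges_disjoint sd by simp
  moreover have "bounded_by_triangle (V, E) straight_drawing X" if X: "X \<in> ?F" for X
  proof -
    obtain t where t: "t \<in> insert t0 T" "X = - (convex hull t) \<or> X = interior (convex hull t)"
      using X by blast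
    then obtain a b c where abc: "t = {a, b, c}" "\<not> collinear {a, b, c}"
      "{{a, b}, {b, c}, {a, c}} \<subseteq> E" using triangle[of t] by blast
    \<comment> \<open>A convex set with nonempty interior has the same closure as its interior, so
      the open face inherits the frontier of the closed triangle.\<close>
    have fr: "frontier (interior (convex hull t)) = frontier (convex hull t)"
      unfolding frontier_def using interior_triangle_nonempty[OF abc(2)]
      by (simp add: abc(1) convex_closure_interior)
    have drawn: "path_image (straight_drawing e) = convex hull e"
      if "e \<in> {{a, b}, {b, c}, {a, c}}" for e
      using that abc(3) by (intro sd(3)) blast
    have "frontier X = frontier (convex hull t)"
      using t(2) fr frontier_complement by metis
    also have "\<dots> = (\<Union>e\<in>{{a, b}, {b, c}, {a, c}}. convex hull e)"
      unfolding abc(1) by (rule frontier_triangle)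
    also have "\<dots> = (\<Union>e\<in>{{a, b}, {b, c}, {a, c}}. path_image (straight_drawing e))"
      by (intro SUP_cong refl drawn[symmetric])
    finally show ?thesis
      unfolding bounded_by_triangle_def snd_conv
      by (intro exI[of _ a] exI[of _ b] exI[of _ c] conjI not_collinear_3D[OF abc(2)] abc(3))
  qed
  ultimately show ?thesis
    unfolding plane_triangulation_def faces by blast
qed

lemma straight_triangulation_triangle:
  assumes "\<not> collinear {a, b, c}"
  shows "straight_triangulation {a, b, c} {{a, b}, {b, c}, {a, c}} {{a, b, c}} {a, b, c}"
proof -
  note n = not_collinear_3D[OF assms]
  have seg: "closed_segment a b \<inter> closed_segment b c = {b}"
    "closed_segment b c \<inter> closed_segment c a = {c}"
    "closed_segment c a \<inter> closed_segment a b = {a}"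
    using assms by (auto intro!: Int_closed_segment simp: insert_commute)
  have int: "interior (convex hull {a, b, c}) =
      convex hull {a, b, c} - (closed_segment a b \<union> closed_segment b c \<union> closed_segment c a)"
    by (rule interior_of_triangle) simp
  have sub: "closed_segment a b \<subseteq> convex hull {a, b, c}" "closed_segment b c \<subseteq> convex hull {a, b, c}"
    "closed_segment c a \<subseteq> convex hull {a, b, c}"
    unfolding segment_convex_hull by (intro hull_mono; blast)+
  have hull: "convex hull {a, b} = closed_segment a b" "convex hull {b, c} = closed_segment b c"
    "convex hull {a, c} = closed_segment c a"
    by (simp_all add: segment_convex_hull insert_commute)
  have mem: "a \<in> closed_segment a b" "b \<in> closed_segment a b" "b \<in> closed_segment b c"
    "c \<in> closed_segment b c" "c \<in> closed_segment c a" "a \<in> closed_segment c a" by auto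
  show ?thesis
  proof
    show "e \<subseteq> {a, b, c} \<and> card e = 2 \<and> (convex hull e - e) \<inter> {a, b, c} = {}"
      if "e \<in> {{a, b}, {b, c}, {a, c}}" for e
      using that n seg mem by (auto simp: hull)
    show "(convex hull e - e) \<inter> convex hull e' = {}"
      if "e \<in> {{a, b}, {b, c}, {a, c}}" "e' \<in> {{a, b}, {b, c}, {a, c}}" "e \<noteq> e'" for e e'
      using that seg by (auto simp: hull)
    show "\<exists>a' b' c'. t = {a', b', c'} \<and> \<not> collinear {a', b', c'} \<and>
        {{a', b'}, {b', c'}, {a', c'}} \<subseteq> {{a, b}, {b, c}, {a, c}}"
      if "t \<in> insert {a, b, c} {{a, b, c}}" for t
      using assms that by blast
    show "interior (convex hull t) \<inter> ({a, b, c} \<union> (\<Union>e\<in>{{a, b}, {b, c}, {a, c}}. convex hull e)) = {}"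
      if "t \<in> {{a, b, c}}" for t
      using that mem by (auto simp: hull int)
    show "convex hull {a, b, c} = {a, b, c} \<union> (\<Union>e\<in>{{a, b}, {b, c}, {a, c}}. convex hull e) \<union>
        (\<Union>t\<in>{{a, b, c}}. interior (convex hull t))"
      using mem sub unfolding UN_insert UN_empty int hull by blast
  qed auto
qed

text \<open>All that is added lies in the open triangle around \<open>p\<close>, except for the ends
  \<open>a\<close>, \<open>b\<close>, \<open>c\<close> of the new segments. That open triangle is
  disjoint from the old drawing and from the other faces, so only the new segments and the new
  triangles have to be compared with one another.\<close>

lemma straight_triangulation_insert:
  assumes st: "straight_triangulation V E T t0" and t: "{a, b, c} \<in> T"
    and p: "p \<in> interior (convex hull {a, b, c})"
  shows "straight_triangulation (insert p V) (E \<union> {{p, a}, {p, b}, {p, c}})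
    (T - {{a, b, c}} \<union> {{p, a, b}, {p, b, c}, {p, a, c}}) t0"
proof -
  interpret straight_triangulation V E T t0 by fact
  \<comment> \<open>Faces are sets, so the locale may list the corners in another order; the edges
    are carried over to \<open>a\<close>, \<open>b\<close>, \<open>c\<close> through arbitrary pairs
    of corners.\<close>
  obtain a' b' c' where abc': "{a, b, c} = {a', b', c'}" "\<not> collinear {a', b', c'}"
    "{{a', b'}, {b', c'}, {a', c'}} \<subseteq> E"
    using triangle[OF insertI2[OF t]] by (elim exE conjE) (rule that)
  have nc: "\<not> collinear {a, b, c}" unfolding abc'(1) by (rule abc'(2))
  note ne = not_collinear_3D[OF nc]
  have "{x, y} \<in> E" if "x \<in> {a', b', c'}" "y \<in> {a', b', c'}" "x \<noteq> y" for x y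
    using that abc'(3) by (auto simp: insert_commute)
  then have "{x, y} \<in> E" if "x \<in> {a, b, c}" "y \<in> {a, b, c}" "x \<noteq> y" for x y
    using that unfolding abc'(1) .
  then have abcE: "{a, b} \<in> E" "{b, c} \<in> E" "{a, c} \<in> E" using ne by simp_all
  then have abcV: "a \<in> V" "b \<in> V" "c \<in> V" using edge by blast+
  \<comment> \<open>\<open>I\<close> is the subdivided open face, \<open>P\<close> the old drawing,
    \<open>S\<close> the union of the new segments and \<open>N\<close> the set of new
    faces.\<close>
  define I where "I = interior (convex hull {a, b, c})"
  define P where "P = V \<union> (\<Union>e\<in>E. convex hull e)"
  define S where "S = closed_segment p a \<union> closed_segment p b \<union> closed_segment p c"
  define N where "N = {{p, a, b}, {p, b, c}, {p, a, c}}"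
  have perm: "{b, c, a} = {a, b, c}" "{a, c, b} = {a, b, c}" "{c, a, b} = {a, b, c}" by auto
  have pI: "p \<in> I" using p by (simp add: I_def)
  have IP: "I \<inter> P = {}" using interior_empty[OF t] unfolding I_def P_def .
  have VP: "V \<subseteq> P" by (auto simp: P_def)
  have hullP: "convex hull e \<subseteq> P" if "e \<in> E" for e using that by (auto simp: P_def)
  have pV: "p \<notin> V" using pI IP VP by blast
  have pn: "p \<noteq> a" "p \<noteq> b" "p \<noteq> c" using pV abcV by auto
  have segI: "closed_segment p x - {p, x} \<subseteq> I - {p}" "closed_segment p x \<subseteq> insert x I"
    if "x \<in> {a, b, c}" for x
  proof -
    have "x \<in> closure (convex hull {a, b, c})"
      using that by (meson closure_subset hull_inc subsetD)
    then have "open_segment p x \<subseteq> I"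
      unfolding I_def by (intro in_interior_closure_convex_segment p convex_convex_hull)
    then show "closed_segment p x - {p, x} \<subseteq> I - {p}" "closed_segment p x \<subseteq> insert x I"
      using pI by (auto simp: open_segment_def)
  qed
  have ncN: "\<not> collinear {p, a, b}" "\<not> collinear {p, b, c}" "\<not> collinear {p, a, c}"
    using not_collinear_interior_point[of a b c p] not_collinear_interior_point[of b c a p]
      not_collinear_interior_point[of a c b p] nc p by (simp_all add: perm)
  have segs: "closed_segment p x \<inter> closed_segment p y = {p}"
    if "x \<in> {a, b, c}" "y \<in> {a, b, c}" "x \<noteq> y" for x y
  proof -
    have "\<not> collinear {x, p, y}"
      using that ncN by (auto simp: insert_commute)
    then have "closed_segment x p \<inter> closed_segment p y = {p}"
      by (intro Int_closed_segment) blast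
    then show ?thesis by (simp add: closed_segment_commute)
  qed
  have pN: "p \<in> convex hull {a, b, c}" using p interior_subset by blast
  have NI: "interior (convex hull t) \<subseteq> I" if "t \<in> N" for t
    unfolding I_def
  proof (intro interior_mono)
    have "t \<subseteq> insert p {a, b, c}" using that by (auto simp: N_def)
    then have "t \<subseteq> convex hull {a, b, c}" using pN hull_subset[of "{a, b, c}" convex] by blast
    then show "convex hull t \<subseteq> convex hull {a, b, c}" by (simp add: subset_hull)
  qed
  have NN: "interior (convex hull t) \<inter> interior (convex hull t') = {}"
    if "t \<in> N" "t' \<in> N" "t \<noteq> t'" for t t'
  proof -
    have "interior (convex hull {p, a, b}) \<inter> interior (convex hull {p, b, c}) = {}"
      "interior (convex hull {p, b, c}) \<inter> interior (convex hull {p, a, c}) = {}"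
      "interior (convex hull {p, a, b}) \<inter> interior (convex hull {p, a, c}) = {}"
      using subtriangles_disjoint[of a b c p] subtriangles_disjoint[of b c a p]
        subtriangles_disjoint[of c a b p] nc p by (auto simp: perm insert_commute[of _ a])
    then show ?thesis using that by (auto simp: N_def)
  qed
  have NS: "interior (convex hull t) \<inter> S = {}" if "t \<in> N" for t
  proof -
    have s: "interior (convex hull {p, x, y}) \<inter> (closed_segment p x \<union> closed_segment p y) = {}" for x y
      using interior_of_triangle[of p x y] by (auto simp: closed_segment_commute)
    have "interior (convex hull {p, a, b}) \<inter> closed_segment p c = {}"
      "interior (convex hull {p, b, c}) \<inter> closed_segment p a = {}"
      "interior (convex hull {p, a, c}) \<inter> closed_segment p b = {}"
      using subtriangle_disjoint_segment[of a b c p] subtriangle_disjoint_segment[of b c a p]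
        subtriangle_disjoint_segment[of a c b p] nc p by (simp_all add: perm)
    then show ?thesis using that s[of a b] s[of b c] s[of a c] by (auto simp: N_def S_def)
  qed
  have SI: "S \<subseteq> I \<union> P" using segI(2)[of a] segI(2)[of b] segI(2)[of c] abcV VP by (auto simp: S_def)
  have pS: "p \<in> S" by (simp add: S_def)
  have coverI: "I \<subseteq> (\<Union>t\<in>N. interior (convex hull t)) \<union> S"
    using interior_triangle_subdivision[OF nc p] unfolding I_def N_def S_def by auto
  have newP: "insert p V \<union> (\<Union>e\<in>E \<union> {{p, a}, {p, b}, {p, c}}. convex hull e) = P \<union> S"
    using pS by (auto simp: P_def S_def segment_convex_hull)
  have new: "\<exists>x\<in>{a, b, c}. e = {p, x}" if "e \<in> {{p, a}, {p, b}, {p, c}}" for e using that by blast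
  show ?thesis
    unfolding N_def[symmetric]
  proof (unfold_locales, unfold newP)
    show "finite (insert p V)" using finite_vertices by simp
  next
    fix e assume e: "e \<in> E \<union> {{p, a}, {p, b}, {p, c}}"
    have "e \<subseteq> insert p V" using e edge abcV by blast
    moreover have "card e = 2" using e edge pn by auto
    moreover have "(convex hull e - e) \<inter> insert p V = {}"
    proof (cases "e \<in> E")
      case True
      then show ?thesis using edge[of e] hullP[of e] pI IP by blast
    next
      case False
      then obtain x where x: "x \<in> {a, b, c}" "e = {p, x}" using e new by blast
      then have "convex hull e - e \<subseteq> I - {p}" using segI(1) by (simp add: segment_convex_hull)
      then show ?thesis using IP VP by blast
    qed
    ultimately show "e \<subseteq> insert p V \<and> card e = 2 \<and> (convex hull e - e) \<inter> insert p V = {}"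
      by blast
  next
    fix e e' assume e: "e \<in> E \<union> {{p, a}, {p, b}, {p, c}}"
      and e': "e' \<in> E \<union> {{p, a}, {p, b}, {p, c}}" and ee': "e \<noteq> e'"
    consider "e \<in> E" "e' \<in> E" | x where "x \<in> {a, b, c}" "e = {p, x}" "e' \<in> E"
      | x where "x \<in> {a, b, c}" "e' = {p, x}" "e \<in> E"
      | x y where "x \<in> {a, b, c}" "y \<in> {a, b, c}" "e = {p, x}" "e' = {p, y}"
      using e e' new by (metis UnE)
    then show "(convex hull e - e) \<inter> convex hull e' = {}"
    proof cases
      case 1
      then show ?thesis using edges_disjoint ee' by blast
    next
      case (2 x)
      then have "convex hull e - e \<subseteq> I" using segI(1)[of x] by (auto simp: segment_convex_hull)
      then show ?thesis using IP hullP[OF 2(3)] by blast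
    next
      case (3 x)
      then have "convex hull e' \<subseteq> insert x I" using segI(2)[of x] by (simp add: segment_convex_hull)
      moreover have "x \<in> V" using 3 abcV by auto
      ultimately show ?thesis using IP hullP[OF 3(3)] edge[OF 3(3)] by blast
    next
      case (4 x y)
      then have "x \<noteq> y" using ee' by blast
      from segs[OF 4(1,2) this] show ?thesis unfolding 4(3,4) by (auto simp: segment_convex_hull)
    qed
  next
    fix t assume "t \<in> insert t0 (T - {{a, b, c}} \<union> N)"
    then consider "t \<in> insert t0 T" | "t = {p, a, b}" | "t = {p, b, c}" | "t = {p, a, c}"
      unfolding N_def by blast
    then show "\<exists>x y z. t = {x, y, z} \<and> \<not> collinear {x, y, z} \<and>
        {{x, y}, {y, z}, {x, z}} \<subseteq> E \<union> {{p, a}, {p, b}, {p, c}}"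
    proof cases
      case 1
      then show ?thesis
        using triangle[OF 1] by (elim exE conjE) (intro exI conjI le_supI1)
    next
      case 2
      show ?thesis unfolding 2
        by (intro exI conjI) (rule refl, rule ncN, use abcE in simp)
    next
      case 3
      show ?thesis unfolding 3
        by (intro exI conjI) (rule refl, rule ncN, use abcE in simp)
    next
      case 4
      show ?thesis unfolding 4
        by (intro exI conjI) (rule refl, rule ncN, use abcE in simp)
    qed
  next
    fix t t' assume t1: "t \<in> T - {{a, b, c}} \<union> N" and t2: "t' \<in> T - {{a, b, c}} \<union> N" and "t \<noteq> t'"
    have mix: "interior (convex hull s) \<inter> interior (convex hull s') = {}"
      if "s \<in> T - {{a, b, c}}" "s' \<in> N" for s s'
      using interiors_disjoint[of s "{a, b, c}"] NI[of s'] t that unfolding I_def by blast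
    show "interior (convex hull t) \<inter> interior (convex hull t') = {}"
    proof (cases "t \<in> N"; cases "t' \<in> N")
      assume "t \<in> N" "t' \<in> N"
      then show ?thesis using \<open>t \<noteq> t'\<close> by (rule NN)
    next
      assume "t \<in> N" "t' \<notin> N"
      then show ?thesis using t2 mix[of t' t] by (simp add: Int_commute)
    next
      assume "t \<notin> N" "t' \<in> N"
      then show ?thesis using t1 mix[of t t'] by simp
    next
      assume "t \<notin> N" "t' \<notin> N"
      then show ?thesis using t1 t2 \<open>t \<noteq> t'\<close> interiors_disjoint[of t t'] by simp
    qed
  next
    fix s assume s: "s \<in> T - {{a, b, c}} \<union> N"
    show "interior (convex hull s) \<inter> (P \<union> S) = {}"
    proof (cases "s \<in> N")
      case True
      then show ?thesis using NS[OF True] NI[OF True] IP by blast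
    next
      case False
      then have sT: "s \<in> T" "s \<noteq> {a, b, c}" using s by auto
      have "interior (convex hull s) \<inter> I = {}" "interior (convex hull s) \<inter> P = {}"
        unfolding I_def P_def
        by (rule interiors_disjoint[OF sT(1) t sT(2)], rule interior_empty[OF sT(1)])
      then show ?thesis using SI by blast
    qed
  next
    define UR where "UR = (\<Union>t\<in>T - {{a, b, c}}. interior (convex hull t))"
    define UT where "UT = (\<Union>t\<in>N. interior (convex hull t))"
    have "convex hull t0 = P \<union> (\<Union>t\<in>insert {a, b, c} (T - {{a, b, c}}). interior (convex hull t))"
      unfolding P_def insert_Diff[OF t] by (rule cover)
    then have h: "convex hull t0 = P \<union> (I \<union> UR)"
      unfolding I_def UR_def UN_insert .
    have "UT \<subseteq> I" using NI by (auto simp: UT_def)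
    moreover have "I \<subseteq> UT \<union> S" using coverI by (simp add: UT_def)
    ultimately have "convex hull t0 = P \<union> S \<union> (UR \<union> UT)"
      unfolding h using SI by blast
    then show "convex hull t0 = P \<union> S \<union> (\<Union>t\<in>T - {{a, b, c}} \<union> N. interior (convex hull t))"
      by (simp add: UR_def UT_def)
  qed
qed

section \<open>Stacked triangulations\<close>

text \<open>Only some of the bounded faces need to be listed in \<open>T\<close>: those still available for stacking.\<close>

definition realizable :: "'a set \<Rightarrow> 'a set set \<Rightarrow> 'a set set \<Rightarrow> bool" where
  "realizable V E T \<longleftrightarrow> \<Union>E \<subseteq> V \<and> \<Union>T \<subseteq> V \<and>
     (\<exists>f T' t0. inj_on f V \<and> straight_triangulation (f ` V) ((`) f ` E) T' t0 \<and> (`) f ` T \<subseteq> T')"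

lemma realizableI:
  assumes "\<Union>E \<subseteq> V" "\<Union>T \<subseteq> V" "inj_on f V"
    "straight_triangulation (f ` V) ((`) f ` E) T' t0" "(`) f ` T \<subseteq> T'"
  shows "realizable V E T"
  unfolding realizable_def using assms by (intro conjI exI)

lemma realizableE:
  assumes "realizable V E T"
  obtains f T' t0 where "\<Union>E \<subseteq> V" "\<Union>T \<subseteq> V" "inj_on f V"
    "straight_triangulation (f ` V) ((`) f ` E) T' t0" "(`) f ` T \<subseteq> T'"
  using assms unfolding realizable_def by (elim conjE exE) (rule that)

lemma realizable_triangle:
  assumes "a \<noteq> b" "a \<noteq> c" "b \<noteq> c"
  shows "realizable {a, b, c} {{a, b}, {b, c}, {a, c}} {{a, b, c}}"
proof -
  define f where "f x = (if x = a then 0 else if x = b then 1 else \<i>)" for x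
  have f: "f a = 0" "f b = 1" "f c = \<i>" using assms by (auto simp: f_def)
  have "\<not> collinear {0, 1, \<i>}"
  proof
    assume "collinear {0, 1, \<i>}"
    then obtain r where "\<i> = r *\<^sub>R (1::complex)" by (auto simp: collinear_lemma)
    then show False by (simp add: complex_eq_iff)
  qed
  then have "straight_triangulation (f ` {a, b, c}) ((`) f ` {{a, b}, {b, c}, {a, c}}) {{0, 1, \<i>}} {0, 1, \<i>}"
    using straight_triangulation_triangle by (simp add: f)
  moreover have "inj_on f {a, b, c}" by (simp add: f inj_on_def)
  ultimately show ?thesis
    by (intro realizableI[where f = f and T' = "{{0, 1, \<i>}}"]) (auto simp: f)
qed

text \<open>The embedding is extended by sending \<open>p\<close> to any point \<open>q\<close>
  inside the image of the face. This point avoids the old vertices, so injectivity survives, and the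
  geometric insertion applies.\<close>

lemma realizable_insert:
  assumes r: "realizable V E T" and t: "{a, b, c} \<in> T" and p: "p \<notin> V"
  shows "realizable (insert p V) (E \<union> {{p, a}, {p, b}, {p, c}})
    (T - {{a, b, c}} \<union> {{p, a, b}, {p, b, c}, {p, a, c}})"
proof -
  obtain f T' t0 where EV: "\<Union>E \<subseteq> V" and TV: "\<Union>T \<subseteq> V" and f: "inj_on f V"
    "straight_triangulation (f ` V) ((`) f ` E) T' t0" "(`) f ` T \<subseteq> T'"
    by (rule realizableE[OF r])
  interpret straight_triangulation "f ` V" "(`) f ` E" T' t0 by fact
  have abcV: "a \<in> V" "b \<in> V" "c \<in> V" using t TV by auto
  have "f ` {a, b, c} \<in> T'" using t f(3) by blast
  then have fT: "{f a, f b, f c} \<in> T'" by simp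
  obtain x y z where xyz: "{f a, f b, f c} = {x, y, z}" "\<not> collinear {x, y, z}"
    using triangle[OF insertI2[OF fT]] by (elim exE conjE) (rule that)
  then obtain q where q: "q \<in> interior (convex hull {f a, f b, f c})"
    using interior_triangle_nonempty[OF xyz(2)] unfolding xyz(1) by blast
  have qV: "q \<notin> f ` V" using interior_empty[OF fT] q by blast
  define g where "g = f(p := q)"
  have gf: "g x = f x" if "x \<in> V" for x
    using that p by (auto simp: g_def)
  have gf_image: "g ` s = f ` s" if "s \<subseteq> V" for s
    using gf that by (intro image_cong refl) blast
  have gE: "(`) g ` E = (`) f ` E"
    by (rule image_cong[OF refl], rule gf_image) (use EV in blast)
  have gq: "g p = q" by (simp add: g_def)
  \<comment> \<open>Injectivity of \<open>f\<close> on \<open>V\<close> keeps the images of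
    different faces different, so no other listed face is destroyed by the stacking.\<close>
  have gT: "g ` t \<in> T' - {{f a, f b, f c}}" if "t \<in> T - {{a, b, c}}" for t
  proof -
    have tT: "t \<in> T" and neq: "t \<noteq> {a, b, c}" using that by simp_all
    have tV: "t \<subseteq> V" using tT TV by blast
    have abc: "{a, b, c} \<subseteq> V" using abcV by simp
    have "f ` t \<noteq> f ` {a, b, c}"
      unfolding inj_on_image_eq_iff[OF f(1) tV abc] by (rule neq)
    moreover have "f ` t \<in> T'" using tT f(3) by blast
    ultimately show ?thesis unfolding gf_image[OF tV] by simp
  qed
  have inj: "inj_on g (insert p V)"
  proof -
    have "inj_on g V" using f(1) gf by (simp cong: inj_on_cong)
    then show ?thesis using p qV gq gf_image[OF subset_refl] by simp
  qed
  have gV: "g ` insert p V = insert q (f ` V)" using gq gf_image[of V] by simp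
  have gE': "(`) g ` (E \<union> {{p, a}, {p, b}, {p, c}}) = (`) f ` E \<union> {{q, f a}, {q, f b}, {q, f c}}"
    using abcV by (simp add: image_Un gE gq gf)
  have gT': "(`) g ` (T - {{a, b, c}} \<union> {{p, a, b}, {p, b, c}, {p, a, c}}) \<subseteq>
    T' - {{f a, f b, f c}} \<union> {{q, f a, f b}, {q, f b, f c}, {q, f a, f c}}"
    unfolding image_Un using abcV gT by (intro Un_mono) (auto simp: gq gf)
  have "straight_triangulation (g ` insert p V) ((`) g ` (E \<union> {{p, a}, {p, b}, {p, c}}))
    (T' - {{f a, f b, f c}} \<union> {{q, f a, f b}, {q, f b, f c}, {q, f a, f c}}) t0"
    unfolding gV gE' by (rule straight_triangulation_insert[OF f(2) fT q])
  moreover have "\<Union>(E \<union> {{p, a}, {p, b}, {p, c}}) \<subseteq> insert p V"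
    "\<Union>(T - {{a, b, c}} \<union> {{p, a, b}, {p, b, c}, {p, a, c}}) \<subseteq> insert p V"
    using EV TV abcV by auto
  ultimately show ?thesis using inj gT' by (intro realizableI)
qed

lemma realizable_mono:
  assumes "realizable V E T" "T' \<subseteq> T"
  shows "realizable V E T'"
proof -
  obtain f T1 t0 where r: "\<Union>E \<subseteq> V" "\<Union>T \<subseteq> V" "inj_on f V"
    "straight_triangulation (f ` V) ((`) f ` E) T1 t0" "(`) f ` T \<subseteq> T1"
    by (rule realizableE[OF assms(1)])
  show ?thesis
    by (rule realizableI[OF r(1) _ r(3,4)]) (use assms(2) r(2,5) in blast)+
qed

section \<open>From abstract coloured graphs to planar anti-Ramsey numbers\<close>

definition path_in :: "'a set \<Rightarrow> 'a set set \<Rightarrow> nat \<Rightarrow> (nat \<Rightarrow> 'a) \<Rightarrow> bool" where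
  "path_in V E k g \<longleftrightarrow> inj_on g {..<k} \<and> g ` {..<k} \<subseteq> V \<and> (\<forall>i. Suc i < k \<longrightarrow> {g i, g (Suc i)} \<in> E)"

text \<open>The embedding moves the abstract graph into the plane, and its inverse pulls copies of
  the path back to vertex sequences. A construction thus only has to supply a stacked graph, one
  path on \<open>k\<close> vertices and a colouring with values in any type.\<close>

lemma planar_anti_ramsey_ge:
  fixes c :: "'a set \<Rightarrow> 'b"
  assumes r: "realizable V E T"
    and path: "path_in V E k g"
    and no_rainbow: "\<And>h. path_in V E k h \<Longrightarrow> \<not> inj_on (\<lambda>i. c {h i, h (Suc i)}) {i. Suc i < k}"
  shows "card (c ` E) \<le> planar_anti_ramsey (card V) (path_graph k)"
proof -
  obtain f T' t0 where EV: "\<Union>E \<subseteq> V" and f: "inj_on f V"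
    "straight_triangulation (f ` V) ((`) f ` E) T' t0"
    by (rule realizableE[OF r])
  have pt: "plane_triangulation (f ` V, (`) f ` E) straight_drawing"
    using f(2) by (rule straight_triangulation_plane)
  then have fin: "finite (f ` V)"
    by (simp add: plane_triangulation_def plane_graph_def simple_graph_def)
  then have "finite V" using f(1) by (rule finite_imageD)
  then have "finite E" using EV by (intro finite_subset[of E "Pow V"]) auto
  then have "finite (c ` E)" by simp
  \<comment> \<open>Only finitely many colours occur, so they can be renamed injectively as natural
    numbers.\<close>
  then obtain enc :: "'b \<Rightarrow> nat" where enc: "inj_on enc (c ` E)"
    using finite_imp_inj_to_nat_seg by metis
  define f' where "f' = the_inv_into V f"
  have f'f: "f' (f v) = v" if "v \<in> V" for v
    using that f(1) by (simp add: f'_def the_inv_into_f_f)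
  have f'f_image: "f' ` f ` e = e" if "e \<subseteq> V" for e
    using that f'f by (force simp: image_image)
  define col where "col e = enc (c (f' ` e))" for e
  have "col (f ` e) = enc (c e)" if "e \<in> E" for e
  proof -
    have "e \<subseteq> V" using EV that by blast
    then show ?thesis by (simp add: col_def f'f_image)
  qed
  then have "col ` ((`) f ` E) = enc ` c ` E"
    by (simp only: image_image) (intro image_cong refl)
  then have card: "card (col ` ((`) f ` E)) = card (c ` E)"
    by (simp add: card_image[OF enc])
  have edges_path: "edges (path_graph k) = {{i, Suc i} | i. Suc i < k}"
    and verts_path: "verts (path_graph k) = {..<k}"
    by (auto simp: path_graph_def)
  let ?G = "(f ` V, (`) f ` E)"
  \<comment> \<open>A rainbow copy, numbered along the path and pulled back to \<open>V\<close>,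
    would be a sequence \<open>h\<close> whose consecutive pairs have distinct colours.\<close>
  have no: "\<not> (\<exists>H'. subgraph H' ?G \<and> isomorphic H' (path_graph k) \<and> rainbow col H')"
  proof
    assume "\<exists>H'. subgraph H' ?G \<and> isomorphic H' (path_graph k) \<and> rainbow col H'"
    then obtain H' where H': "subgraph H' ?G" "isomorphic H' (path_graph k)" "rainbow col H'" by blast
    obtain \<phi> where \<phi>: "bij_betw \<phi> (verts H') {..<k}"
      "\<And>u v. u \<in> verts H' \<Longrightarrow> v \<in> verts H' \<Longrightarrow> {u, v} \<in> edges H' \<longleftrightarrow> {\<phi> u, \<phi> v} \<in> edges (path_graph k)"
      using H'(2) unfolding isomorphic_def verts_path by blast
    define \<psi> where "\<psi> = the_inv_into (verts H') \<phi>"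
    have \<psi>: "bij_betw \<psi> {..<k} (verts H')"
      unfolding \<psi>_def using \<phi>(1) by (rule bij_betw_the_inv_into)
    have \<phi>\<psi>: "\<phi> (\<psi> i) = i" if "i < k" for i
      unfolding \<psi>_def using \<phi>(1) that by (auto intro!: f_the_inv_into_f simp: bij_betw_def)
    have \<psi>H: "\<psi> i \<in> verts H'" if "i < k" for i
      using \<psi> that by (auto simp: bij_betw_def)
    have \<psi>e: "{\<psi> i, \<psi> (Suc i)} \<in> edges H'" if "Suc i < k" for i
      using \<phi>(2)[of "\<psi> i" "\<psi> (Suc i)"] \<psi>H \<phi>\<psi> that by (auto simp: edges_path)
    have HV: "verts H' \<subseteq> f ` V" "edges H' \<subseteq> (`) f ` E"
      using H'(1) by (auto simp: subgraph_def)
    define h where "h i = f' (\<psi> i)" for i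
    have fh: "f (h i) = \<psi> i" "h i \<in> V" if "i < k" for i
      using \<psi>H[OF that] HV(1) f'f by (auto simp: h_def)
    have "path_in V E k h"
      unfolding path_in_def
    proof (intro conjI allI impI)
      show "inj_on h {..<k}"
        using \<psi> fh by (metis bij_betw_def inj_on_def lessThan_iff)
      show "h ` {..<k} \<subseteq> V" using fh by auto
      fix i assume i: "Suc i < k"
      then obtain e where e: "e \<in> E" "f ` e = {\<psi> i, \<psi> (Suc i)}" using \<psi>e[OF i] HV(2) by auto
      then have "e \<subseteq> V" using EV by blast
      then have "e = f' ` {\<psi> i, \<psi> (Suc i)}" using e(2) f'f_image by metis
      then show "{h i, h (Suc i)} \<in> E" using e(1) by (simp add: h_def)
    qed
    moreover have "inj_on (\<lambda>i. c {h i, h (Suc i)}) {i. Suc i < k}"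
    proof (rule inj_onI)
      fix i j assume i: "i \<in> {i. Suc i < k}" and j: "j \<in> {i. Suc i < k}"
        and eq: "c {h i, h (Suc i)} = c {h j, h (Suc j)}"
      have "col {\<psi> i, \<psi> (Suc i)} = col {\<psi> j, \<psi> (Suc j)}"
        using eq by (simp add: col_def h_def)
      then have "{\<psi> i, \<psi> (Suc i)} = {\<psi> j, \<psi> (Suc j)}"
        using H'(3) \<psi>e i j unfolding rainbow_def by (auto dest: inj_onD)
      then have "\<phi> ` {\<psi> i, \<psi> (Suc i)} = \<phi> ` {\<psi> j, \<psi> (Suc j)}" by simp
      then have "{i, Suc i} = {j, Suc j}" using i j \<phi>\<psi> by simp
      then show "i = j" by (auto simp: doubleton_eq_iff)
    qed
    ultimately show False using no_rainbow by blast
  qed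
  \<comment> \<open>The triangulation must also contain some copy of the path, whatever its colours;
    the image of \<open>g\<close> is one.\<close>
  have g: "inj_on g {..<k}" "g ` {..<k} \<subseteq> V" "\<And>i. Suc i < k \<Longrightarrow> {g i, g (Suc i)} \<in> E"
    using path by (auto simp: path_in_def)
  define fg where "fg = f \<circ> g"
  have fg: "inj_on fg {..<k}"
    unfolding fg_def using g(1,2) f(1) by (intro comp_inj_on) (auto intro: inj_on_subset)
  let ?H = "(fg ` {..<k}, (`) fg ` edges (path_graph k))"
  have "isomorphic ?H (path_graph k)"
  proof -
    define \<phi> where "\<phi> = the_inv_into {..<k} fg"
    have \<phi>: "\<phi> (fg i) = i" if "i < k" for i
      using that fg by (simp add: \<phi>_def the_inv_into_f_f)
    have "bij_betw \<phi> (fg ` {..<k}) {..<k}"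
      unfolding \<phi>_def using fg by (simp add: bij_betw_the_inv_into inj_on_imp_bij_betw)
    moreover have "{u, v} \<in> (`) fg ` edges (path_graph k) \<longleftrightarrow> {\<phi> u, \<phi> v} \<in> edges (path_graph k)"
      if uv: "u \<in> fg ` {..<k}" "v \<in> fg ` {..<k}" for u v
    proof -
      obtain i j where ij: "i < k" "j < k" "u = fg i" "v = fg j" using uv by blast
      have "{fg i, fg j} \<in> (`) fg ` edges (path_graph k) \<longleftrightarrow> {i, j} \<in> edges (path_graph k)"
      proof
        assume "{fg i, fg j} \<in> (`) fg ` edges (path_graph k)"
        then obtain e where e: "e \<in> edges (path_graph k)" "fg ` {i, j} = fg ` e" by auto
        moreover have "e \<subseteq> {..<k}" "{i, j} \<subseteq> {..<k}" using e(1) ij by (auto simp: edges_path)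
        ultimately show "{i, j} \<in> edges (path_graph k)"
          using inj_on_image_eq_iff[OF fg] by metis
      next
        assume "{i, j} \<in> edges (path_graph k)"
        then have "fg ` {i, j} \<in> (`) fg ` edges (path_graph k)" by (rule imageI)
        then show "{fg i, fg j} \<in> (`) fg ` edges (path_graph k)" by simp
      qed
      then show ?thesis using \<phi> ij by simp
    qed
    ultimately show ?thesis
      unfolding isomorphic_def verts_path by (intro exI[of _ \<phi>]) simp
  qed
  moreover have "subgraph ?H ?G"
    unfolding subgraph_def simple_graph_def
  proof (intro conjI ballI)
    fix e assume "e \<in> edges ?H"
    then obtain i where i: "Suc i < k" "e = {fg i, fg (Suc i)}" by (auto simp: edges_path)
    then have "fg i \<noteq> fg (Suc i)" using inj_onD[OF fg, of i "Suc i"] by auto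
    then show "e \<subseteq> verts ?H" "card e = 2" using i by auto
  next
    show "edges ?H \<subseteq> edges ?G"
    proof
      fix e assume "e \<in> edges ?H"
      then obtain i where i: "Suc i < k" "e = fg ` {i, Suc i}" by (auto simp: edges_path)
      then have "e = f ` {g i, g (Suc i)}" by (simp add: fg_def)
      then show "e \<in> edges ?G" unfolding snd_conv using g(3)[OF i(1)] by (rule image_eqI)
    qed
    show "verts ?H \<subseteq> verts ?G" using g(2) by (auto simp: fg_def)
  qed simp
  moreover have "card (f ` V) = card V" using f(1) by (rule card_image)
  ultimately have "(?G, straight_drawing) \<in> triangulations_containing (card V) (path_graph k)"
    unfolding triangulations_containing_def using pt by auto
  then have "card (col ` edges ?G) \<in> color_numbers (card V) (path_graph k)"
    unfolding color_numbers_def using no by blast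
  then have "card (c ` E) \<in> color_numbers (card V) (path_graph k)"
    using card by simp
  then show ?thesis
    unfolding planar_anti_ramsey_def by (rule Max_ge[OF finite_color_numbers])
qed

section \<open>Colourings without rainbow paths\<close>

text \<open>Explicit paths are written as lists; a list longer than \<open>k\<close> serves through
  its first \<open>k\<close> entries.\<close>

lemma path_in_nth:
  assumes "distinct xs" "k \<le> length xs" "set xs \<subseteq> V" "successively (\<lambda>x y. {x, y} \<in> E) xs"
  shows "path_in V E k ((!) xs)"
  unfolding path_in_def
proof (intro conjI allI impI)
  show "inj_on ((!) xs) {..<k}" using assms(1,2) by (intro inj_on_nth) auto
  show "(!) xs ` {..<k} \<subseteq> V" using assms(2,3) by (auto dest!: nth_mem)
  show "{xs ! i, xs ! Suc i} \<in> E" if "Suc i < k" for i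
    using successively_nth[OF assms(4), of i] assms(2) that by linarith
qed

lemma path_in_card_le:
  assumes "path_in V E k h" "finite C"
  shows "card {i. i < k \<and> h i \<in> C} \<le> card C"
proof -
  have "inj_on h {i. i < k \<and> h i \<in> C}"
    using assms(1) unfolding path_in_def by (auto intro: inj_on_subset)
  then show ?thesis using assms(2) by (intro card_inj_on_le) auto
qed

text \<open>As \<open>S\<close> is independent, an edge meeting \<open>S\<close> is coloured by its
  single end in \<open>S\<close>. A path has at most \<open>card (V - S)\<close> vertices off
  \<open>S\<close>, hence at least three in \<open>S\<close>. One of these is internal, and its two
  path edges share a colour.\<close>

lemma star_colouring_not_rainbow:
  assumes path: "path_in V E k h" and "finite V" and few: "card (V - S) + 3 \<le> k"
    and indep: "\<And>x y. \<lbrakk>{x, y} \<in> E; x \<in> S\<rbrakk> \<Longrightarrow> y \<notin> S"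
  shows "\<not> inj_on (\<lambda>i. let e = {h i, h (Suc i)} in if e \<inter> S = {} then e else e \<inter> S) {i. Suc i < k}"
proof
  let ?c = "\<lambda>i. let e = {h i, h (Suc i)} in if e \<inter> S = {} then e else e \<inter> S"
  assume inj: "inj_on ?c {i. Suc i < k}"
  let ?J = "{i. i < k \<and> h i \<in> S}"
  have V: "h i \<in> V" if "i < k" for i using path that by (auto simp: path_in_def)
  have edge: "{h i, h (Suc i)} \<in> E" if "Suc i < k" for i using path that by (auto simp: path_in_def)
  have "{..<k} = {i. i < k \<and> h i \<in> V - S} \<union> ?J" using V by auto
  then have "k \<le> card {i. i < k \<and> h i \<in> V - S} + card ?J"
    using card_Un_le[of "{i. i < k \<and> h i \<in> V - S}" ?J] by (metis card_lessThan)
  then have "3 \<le> card ?J"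
    using path_in_card_le[OF path, of "V - S"] \<open>finite V\<close> few by auto
  moreover have "card {0, k - 1} \<le> 2" by (simp add: card_insert_if)
  \<comment> \<open>The positions \<open>0\<close> and \<open>k - 1\<close> are the ends of the
    path; a further position in \<open>?J\<close> is internal.\<close>
  ultimately have "\<not> ?J \<subseteq> {0, k - 1}"
    using card_mono[of "{0, k - 1}" ?J] by auto
  then obtain j where j: "j < k" "h j \<in> S" "j \<noteq> 0" "j \<noteq> k - 1" by blast
  then obtain i where i: "j = Suc i" by (cases j) auto
  have Si: "Suc (Suc i) < k" using j i by simp
  have "h i \<notin> S" "h (Suc (Suc i)) \<notin> S"
    using indep[of "h (Suc i)" "h i"] indep[of "h (Suc i)" "h (Suc (Suc i))"]
      edge[of i] edge[of "Suc i"] Si j i by (auto simp: insert_commute)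
  then have "?c i = {h j}" "?c (Suc i) = {h j}" using j i by (auto simp: Let_def)
  then have "i = Suc i" using inj_onD[OF inj, of i "Suc i"] Si by simp
  then show False by simp
qed

text \<open>Each core vertex lies on at most two path edges, and a rainbow path has at most one edge
  missing the core. So a rainbow path has at most \<open>2 * card C + 1\<close> edges, which is less
  than \<open>k - 1\<close>.\<close>

lemma core_colouring_not_rainbow:
  assumes path: "path_in V E k h" and "finite C" and few: "2 * card C + 2 < k"
  shows "\<not> inj_on (\<lambda>i. let e = {h i, h (Suc i)} in if e \<inter> C = {} then {} else e) {i. Suc i < k}"
proof
  let ?c = "\<lambda>i. let e = {h i, h (Suc i)} in if e \<inter> C = {} then {} else e"
  assume inj: "inj_on ?c {i. Suc i < k}"
  \<comment> \<open>Edge \<open>i\<close> joins \<open>h i\<close> to \<open>h (Suc i)\<close>: it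
    has its first end in \<open>C\<close> if \<open>i\<close> is in \<open>?J\<close>, its second
    end in \<open>C\<close> if \<open>i\<close> is in \<open>?K\<close>, and misses \<open>C\<close>
    if \<open>i\<close> is in \<open>?B\<close>.\<close>
  let ?J = "{i. i < k \<and> h i \<in> C}" and ?K = "{i. Suc i < k \<and> h (Suc i) \<in> C}"
  let ?B = "{i. Suc i < k \<and> h i \<notin> C \<and> h (Suc i) \<notin> C}"
  have fin: "finite ?J" "finite ?K" "finite ?B"
    by (auto intro: finite_subset[of _ "{..<k}"])
  have "\<forall>i\<in>?B. \<forall>j\<in>?B. i = j"
    using inj by (auto simp: inj_on_def)
  then have B: "card ?B \<le> 1"
    using fin(3) by (simp add: card_le_Suc0_iff_eq)
  have "card ?K = card (Suc ` ?K)" by (simp add: card_image)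
  also have "\<dots> \<le> card ?J" using fin by (intro card_mono) auto
  finally have K: "card ?K \<le> card ?J" .
  have "{..<k - 1} \<subseteq> ?J \<union> ?K \<union> ?B" by auto
  then have "k - 1 \<le> card (?J \<union> ?K \<union> ?B)"
    using card_mono[of "?J \<union> ?K \<union> ?B" "{..<k - 1}"] fin by simp
  also have "\<dots> \<le> card ?J + card ?K + card ?B"
    using card_Un_le[of "?J \<union> ?K" ?B] card_Un_le[of ?J ?K] by linarith
  finally show False
    using B K path_in_card_le[OF path \<open>finite C\<close>] few by linarith
qed

lemma card_insert_star:
  assumes "finite E" "\<Union>E \<subseteq> V" "p \<notin> V" "a \<noteq> b" "a \<noteq> c" "b \<noteq> c"
  shows "card (E \<union> {{p, a}, {p, b}, {p, c}}) = card E + 3"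
proof -
  define S where "S = {{p, a}, {p, b}, {p, c}}"
  have "card S = 3"
    using assms(4-6) by (auto simp: S_def card_insert_if doubleton_eq_iff)
  moreover have "E \<inter> S = {}" using assms(2,3) by (auto simp: S_def)
  moreover have "finite S" by (simp add: S_def)
  ultimately show ?thesis using assms(1) by (simp add: card_Un_disjoint flip: S_def)
qed

section \<open>Double fans with tips\<close>

text \<open>\<open>Tip b i\<close> is the vertex stacked into the face of \<open>Hub b\<close> over
  the spine edge from \<open>Spine i\<close> to \<open>Spine (Suc i)\<close>; the pair
  \<open>(b, i)\<close> indexes both the face and its tip.\<close>

datatype vertex = Hub bool | Spine nat | Tip bool nat

definition fan_verts :: "nat \<Rightarrow> vertex set" where
  "fan_verts N = {Hub True, Hub False} \<union> Spine ` {..N}"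

definition fan_edges :: "nat \<Rightarrow> vertex set set" where
  "fan_edges N = {{Hub True, Hub False}} \<union> (\<lambda>i. {Hub True, Spine i}) ` {..N} \<union>
     (\<lambda>i. {Hub False, Spine i}) ` {..N} \<union> (\<lambda>i. {Spine i, Spine (Suc i)}) ` {..<N}"

definition fan_face :: "bool \<times> nat \<Rightarrow> vertex set" where
  "fan_face = (\<lambda>(b, i). {Hub b, Spine i, Spine (Suc i)})"

definition tip :: "bool \<times> nat \<Rightarrow> vertex" where
  "tip = (\<lambda>(b, i). Tip b i)"

definition tip_edges :: "bool \<times> nat \<Rightarrow> vertex set set" where
  "tip_edges = (\<lambda>(b, i). {{Tip b i, Hub b}, {Tip b i, Spine i}, {Tip b i, Spine (Suc i)}})"

definition tipped_verts :: "nat \<Rightarrow> (bool \<times> nat) set \<Rightarrow> vertex set" where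
  "tipped_verts N A = fan_verts N \<union> tip ` A"

definition tipped_edges :: "nat \<Rightarrow> (bool \<times> nat) set \<Rightarrow> vertex set set" where
  "tipped_edges N A = fan_edges N \<union> (\<Union>x\<in>A. tip_edges x)"

lemma fan_verts_Suc: "fan_verts (Suc N) = insert (Spine (Suc N)) (fan_verts N)"
  by (auto simp: fan_verts_def atMost_Suc)

lemma fan_edges_Suc: "fan_edges (Suc N) = fan_edges N \<union>
    {{Spine (Suc N), Hub True}, {Spine (Suc N), Hub False}, {Spine (Suc N), Spine N}}"
proof -
  have swap: "{Spine (Suc N), Hub b} = {Hub b, Spine (Suc N)}"
    "{Spine (Suc N), Spine N} = {Spine N, Spine (Suc N)}" for b by blast+
  show ?thesis
    unfolding swap fan_edges_def atMost_Suc lessThan_Suc image_insert by blast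
qed

lemma finite_fan: "finite (fan_verts N)" "finite (fan_edges N)"
  by (simp_all add: fan_verts_def fan_edges_def)

lemma card_fan_verts: "card (fan_verts N) = N + 3"
proof -
  have "card (Spine ` {..N}) = N + 1" by (simp add: card_image inj_on_def)
  moreover have "{Hub True, Hub False} \<inter> Spine ` {..N} = {}" by auto
  ultimately show ?thesis by (simp add: fan_verts_def card_Un_disjoint)
qed

lemma fan_edges_subset: "\<Union>(fan_edges N) \<subseteq> fan_verts N"
  by (auto simp: fan_edges_def fan_verts_def)

lemma card_fan_edges: "card (fan_edges N) = 3 * N + 3"
proof (induction N)
  case 0
  then show ?case by (simp add: fan_edges_def doubleton_eq_iff)
next
  case (Suc N)
  have "Spine (Suc N) \<notin> fan_verts N" by (auto simp: fan_verts_def)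
  then show ?case
    unfolding fan_edges_Suc
    using card_insert_star[OF finite_fan(2) fan_edges_subset] Suc by simp
qed

text \<open>The next spine vertex is stacked into the face containing both hubs. This creates the
  next face of that kind and the two fan faces over the new spine edge.\<close>

lemma realizable_fan:
  "realizable (fan_verts N) (fan_edges N)
     (insert {Hub True, Hub False, Spine N} (fan_face ` (UNIV \<times> {..<N})))"
proof (induction N)
  case 0
  have "fan_verts 0 = {Hub True, Hub False, Spine 0}"
    and "fan_edges 0 = {{Hub True, Hub False}, {Hub False, Spine 0}, {Hub True, Spine 0}}"
    by (auto simp: fan_verts_def fan_edges_def)
  then show ?case using realizable_triangle[of "Hub True" "Hub False" "Spine 0"] by simp
next
  case (Suc N)
  let ?T = "fan_face ` (UNIV \<times> {..<N})" and ?t = "{Hub True, Hub False, Spine N}"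
  have "Spine (Suc N) \<notin> fan_verts N" by (auto simp: fan_verts_def)
  from realizable_insert[OF Suc.IH insertI1 this]
  have r: "realizable (fan_verts (Suc N)) (fan_edges (Suc N))
    (insert ?t ?T - {?t} \<union> {{Spine (Suc N), Hub True, Hub False},
       {Spine (Suc N), Hub False, Spine N}, {Spine (Suc N), Hub True, Spine N}})"
    unfolding fan_verts_Suc fan_edges_Suc .
  \<comment> \<open>The face used up contains both hubs and a fan face only one, so all earlier fan
    faces stay available.\<close>
  have "?t \<noteq> fan_face (b, i)" for b i
  proof -
    have "Hub (\<not> b) \<in> ?t" by (cases b) simp_all
    moreover have "Hub (\<not> b) \<notin> fan_face (b, i)" by (simp add: fan_face_def)
    ultimately show ?thesis by metis
  qed
  then have T: "insert ?t ?T - {?t} = ?T" by (intro Diff_insert_absorb) auto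
  have faces: "{Spine (Suc N), Hub True, Hub False} = {Hub True, Hub False, Spine (Suc N)}"
    "{Spine (Suc N), Hub b, Spine N} = fan_face (b, N)" for b
    unfolding fan_face_def by auto
  have "fan_face ` (UNIV \<times> {..<Suc N}) \<subseteq> ?T \<union> {fan_face (True, N), fan_face (False, N)}"
    by (auto simp: lessThan_Suc UNIV_bool)
  then show ?case
    by (intro realizable_mono[OF r[unfolded T faces]]) blast
qed

text \<open>This ensures that stacking a tip into one fan face leaves the faces of all other indices
  available.\<close>

lemma inj_fan_face: "inj fan_face"
proof (rule injI, clarify)
  fix b i b' i' assume eq: "fan_face (b, i) = fan_face (b', i')"
  have "Hub b \<in> fan_face (b', i')" "Spine i \<in> fan_face (b', i')" "Spine i' \<in> fan_face (b, i)"
    "Spine (Suc i) \<in> fan_face (b', i')"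
    using eq by (auto simp: fan_face_def)
  then show "b = b' \<and> i = i'" by (auto simp: fan_face_def)
qed

lemma inj_tip: "inj tip"
  by (auto simp: inj_def tip_def)

lemma tip_notin_fan: "tip x \<notin> fan_verts N"
  by (auto simp: tip_def fan_verts_def split: prod.split)

lemma card_tipped_verts:
  assumes "finite A"
  shows "card (tipped_verts N A) = N + 3 + card A"
proof -
  have "fan_verts N \<inter> tip ` A = {}" using tip_notin_fan by auto
  then show ?thesis
    using assms finite_fan inj_tip card_image[of tip A]
    by (simp add: tipped_verts_def card_Un_disjoint card_fan_verts inj_on_subset)
qed

lemma finite_tipped:
  assumes "finite A"
  shows "finite (tipped_verts N A)" "finite (tipped_edges N A)"
  using assms finite_fan by (auto simp: tipped_verts_def tipped_edges_def tip_edges_def)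

text \<open>Tips are stacked one at a time into faces not yet used. The edge count is part of the
  same induction because it needs the old edges to lie in the old vertex set: then the three edges
  at the new tip are new.\<close>

lemma realizable_tipped:
  assumes "finite A" "A \<subseteq> UNIV \<times> {..<N}"
  shows "realizable (tipped_verts N A) (tipped_edges N A) (fan_face ` (UNIV \<times> {..<N} - A)) \<and>
    \<Union>(tipped_edges N A) \<subseteq> tipped_verts N A \<and> card (tipped_edges N A) = 3 * N + 3 + 3 * card A"
  using assms
proof (induction A)
  case empty
  then show ?case
    using realizable_mono[OF realizable_fan, of "fan_face ` (UNIV \<times> {..<N})" N]
      fan_edges_subset[of N] card_fan_edges[of N] by (auto simp: tipped_verts_def tipped_edges_def)
next
  case (insert x A)
  obtain b i where x: "x = (b, i)" by (cases x)
  have xN: "x \<in> UNIV \<times> {..<N} - A" using insert by auto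
  have IH: "realizable (tipped_verts N A) (tipped_edges N A) (fan_face ` (UNIV \<times> {..<N} - A))"
    "\<Union>(tipped_edges N A) \<subseteq> tipped_verts N A" "card (tipped_edges N A) = 3 * N + 3 + 3 * card A"
    using insert by auto
  have "fan_face x \<in> fan_face ` (UNIV \<times> {..<N} - A)" using xN by (rule imageI)
  then have face: "{Hub b, Spine i, Spine (Suc i)} \<in> fan_face ` (UNIV \<times> {..<N} - A)"
    by (simp add: fan_face_def x)
  have new: "tip x \<notin> tipped_verts N A"
    using insert.hyps(2) inj_tip tip_notin_fan by (auto simp: tipped_verts_def dest: injD)
  have V: "tipped_verts N (insert x A) = insert (tip x) (tipped_verts N A)" by (simp add: tipped_verts_def)
  have E: "tipped_edges N (insert x A) =
      tipped_edges N A \<union> {{tip x, Hub b}, {tip x, Spine i}, {tip x, Spine (Suc i)}}"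
    by (auto simp: tipped_edges_def tip_edges_def tip_def x)
  have "fan_face ` (UNIV \<times> {..<N} - insert x A) = fan_face ` (UNIV \<times> {..<N} - A) - {fan_face x}"
    using inj_fan_face by (auto dest: injD)
  then have "fan_face ` (UNIV \<times> {..<N} - insert x A) \<subseteq>
      fan_face ` (UNIV \<times> {..<N} - A) - {{Hub b, Spine i, Spine (Suc i)}}"
    by (simp add: fan_face_def x)
  then have "realizable (tipped_verts N (insert x A)) (tipped_edges N (insert x A))
      (fan_face ` (UNIV \<times> {..<N} - insert x A))"
    unfolding V E by (intro realizable_mono[OF realizable_insert[OF IH(1) face new]]) (rule le_supI1)
  moreover have "\<Union>(tipped_edges N (insert x A)) \<subseteq> tipped_verts N (insert x A)"
    unfolding V E Union_Un_distrib[of "tipped_edges N A"]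
    by (rule Un_least, rule subset_insertI2[OF IH(2)]) (use xN in \<open>auto simp: tipped_verts_def fan_verts_def x\<close>)
  moreover have "card (tipped_edges N (insert x A)) = 3 * N + 3 + 3 * card (insert x A)"
    unfolding E using card_insert_star[OF finite_tipped(2)[OF insert.hyps(1)] IH(2) new] IH(3) insert.hyps by simp
  ultimately show ?case by blast
qed

text \<open>No fan edge contains a tip, and an edge created with a tip has its other end on a hub or
  on the spine. This is the independence required for the star colouring.\<close>

lemma tips_independent:
  assumes "{x, y} \<in> tipped_edges N A" "x \<in> range tip"
  shows "y \<notin> range tip"
proof -
  have "x \<notin> fan_verts N" using assms(2) tip_notin_fan by auto
  then have "{x, y} \<notin> fan_edges N" using fan_edges_subset[of N] by auto
  then obtain z where "{x, y} \<in> tip_edges z" using assms(1) by (auto simp: tipped_edges_def)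
  then show ?thesis using assms(2)
    by (auto simp: tip_edges_def tip_def doubleton_eq_iff split: prod.splits)
qed

lemma tipped_edgesI:
  "{Hub True, Hub False} \<in> tipped_edges N A"
  "i \<le> N \<Longrightarrow> {Hub b, Spine i} \<in> tipped_edges N A"
  "i \<le> N \<Longrightarrow> {Spine i, Hub b} \<in> tipped_edges N A"
  "i < N \<Longrightarrow> {Spine i, Spine (Suc i)} \<in> tipped_edges N A"
  "(b, i) \<in> A \<Longrightarrow> {Spine i, Tip b i} \<in> tipped_edges N A"
  "(b, i) \<in> A \<Longrightarrow> {Tip b i, Spine (Suc i)} \<in> tipped_edges N A"
proof -
  show "i \<le> N \<Longrightarrow> {Hub b, Spine i} \<in> tipped_edges N A"
    by (cases b) (auto simp: tipped_edges_def fan_edges_def)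
  then show "i \<le> N \<Longrightarrow> {Spine i, Hub b} \<in> tipped_edges N A"
    by (simp add: insert_commute)
  show "i < N \<Longrightarrow> {Spine i, Spine (Suc i)} \<in> tipped_edges N A"
    by (auto simp: tipped_edges_def fan_edges_def)
  show "(b, i) \<in> A \<Longrightarrow> {Spine i, Tip b i} \<in> tipped_edges N A"
    "(b, i) \<in> A \<Longrightarrow> {Tip b i, Spine (Suc i)} \<in> tipped_edges N A"
    unfolding tipped_edges_def
    by (rule UnI2, rule UN_I, assumption, simp add: tip_edges_def insert_commute)+
qed (simp add: tipped_edges_def fan_edges_def)

lemma tipped_vertsI:
  "Hub b \<in> tipped_verts N A"
  "i \<le> N \<Longrightarrow> Spine i \<in> tipped_verts N A"
  "(b, i) \<in> A \<Longrightarrow> Tip b i \<in> tipped_verts N A"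
  by (cases b; auto simp: tipped_verts_def fan_verts_def)
    (auto simp: tipped_verts_def fan_verts_def tip_def rev_image_eqI)

section \<open>Explicit paths in fans with tips\<close>

fun zigzag :: "nat \<Rightarrow> vertex list" where
  "zigzag 0 = [Spine 1]"
| "zigzag (Suc j) = zigzag j @ [Tip True (Suc j), Spine (Suc (Suc j))]"

lemma zigzag_properties:
  "zigzag j \<noteq> []" "hd (zigzag j) = Spine 1" "last (zigzag j) = Spine (Suc j)"
  "length (zigzag j) = 2 * j + 1"
  "set (zigzag j) = Spine ` {1..Suc j} \<union> Tip True ` {1..j}"
  "distinct (zigzag j)"
proof (induction j)
  case (Suc j)
  case 5
  show ?case using Suc(5) by (auto simp: atLeastAtMostSuc_conv)
  case 6
  show ?case using Suc(5,6) by auto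
qed auto

lemma zigzag_path:
  assumes "j < N" "{True} \<times> {1..j} \<subseteq> A"
  shows "successively (\<lambda>x y. {x, y} \<in> tipped_edges N A) (zigzag j)"
  using assms
proof (induction j)
  case (Suc j)
  have "(True, Suc j) \<in> A" using Suc.prems by auto
  moreover have "successively (\<lambda>x y. {x, y} \<in> tipped_edges N A) (zigzag j)"
    using Suc by (intro Suc.IH) auto
  moreover have "Suc j < N" using Suc.prems by simp
  ultimately show ?case
    unfolding zigzag.simps successively_append_iff
    by (simp add: zigzag_properties tipped_edgesI)
qed simp

lemma spine_path:
  assumes "b \<le> Suc N"
  shows "successively (\<lambda>x y. {x, y} \<in> tipped_edges N A) (map Spine [a..<b])"
proof -
  have "{map Spine [a..<b] ! i, map Spine [a..<b] ! Suc i} \<in> tipped_edges N A" if "Suc i < b - a" for i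
    using that assms tipped_edgesI(4)[of "a + i" N A] by (simp)
  then show ?thesis by (simp add: successively_conv_nth)
qed

text \<open>The path follows the spine from \<open>Spine 0\<close> to \<open>Spine N\<close>, with
  detours through the first three tips at \<open>Hub True\<close>, and ends with the two hubs. It
  visits all \<open>N + 3\<close> fan vertices and three tips.\<close>

lemma short_path:
  assumes "4 \<le> N" "{True} \<times> {..<3} \<subseteq> A"
  shows "\<exists>g. path_in (tipped_verts N A) (tipped_edges N A) (N + 6) g"
proof
  define ys where "ys = [Spine 0, Tip True 0, Spine 1, Tip True 1, Spine 2, Tip True 2]"
  define zs where "zs = map Spine [3..<Suc N]"
  define xs where "xs = ys @ zs @ [Hub True, Hub False]"
  have zs: "set zs = Spine ` {3..N}" "distinct zs" "length zs = N - 2" "zs \<noteq> []"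
    "hd zs = Spine 3" "last zs = Spine N"
    using assms(1) by (auto simp: zs_def distinct_map inj_on_def hd_map last_map simp del: upt_Suc)
  have A: "(True, 0) \<in> A" "(True, 1) \<in> A" "(True, 2) \<in> A" using assms(2) by auto
  show "path_in (tipped_verts N A) (tipped_edges N A) (N + 6) ((!) xs)"
  proof (rule path_in_nth)
    show "distinct xs" using zs(2) by (auto simp: xs_def ys_def zs(1))
    show "N + 6 \<le> length xs" using assms(1) by (simp add: xs_def ys_def zs(3))
    show "set xs \<subseteq> tipped_verts N A"
      using A assms(1) by (auto simp: xs_def ys_def zs(1) intro!: tipped_vertsI)
    have "successively (\<lambda>x y. {x, y} \<in> tipped_edges N A) ys"
      using tipped_edgesI(5)[OF A(1), of N] tipped_edgesI(6)[OF A(1), of N]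
        tipped_edgesI(5)[OF A(2), of N] tipped_edgesI(6)[OF A(2), of N] tipped_edgesI(5)[OF A(3), of N]
      by (simp add: ys_def numeral_2_eq_2)
    moreover have "{last ys, hd zs} \<in> tipped_edges N A"
      using tipped_edgesI(6)[OF A(3), of N] by (simp add: ys_def zs(5) numeral_2_eq_2 numeral_3_eq_3)
    moreover have "successively (\<lambda>x y. {x, y} \<in> tipped_edges N A) zs"
      unfolding zs_def by (rule spine_path) simp
    ultimately show "successively (\<lambda>x y. {x, y} \<in> tipped_edges N A) xs"
      using zs(4) by (simp add: xs_def successively_append_iff zs(6) tipped_edgesI(1,3))
  qed
qed

text \<open>The path descends the spine from \<open>Spine N\<close> to \<open>Spine (Suc s)\<close>,
  passes through \<open>Hub True\<close>, \<open>Spine 0\<close>, \<open>Hub False\<close>, and then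
  alternates between spine and tips from \<open>Spine 1\<close> to \<open>Spine s\<close>. Its parts
  have \<open>N - s\<close>, \<open>3\<close> and \<open>2 * (s - 1) + 1\<close> vertices.\<close>

lemma long_path:
  assumes "1 \<le> s" "s < N" "{True} \<times> {1..<s} \<subseteq> A" "k \<le> N + s + 2"
  shows "\<exists>g. path_in (tipped_verts N A) (tipped_edges N A) k g"
proof
  define ys where "ys = rev (map Spine [Suc s..<Suc N])"
  define zs where "zs = zigzag (s - 1)"
  define xs where "xs = ys @ [Hub True, Spine 0, Hub False] @ zs"
  have ys: "set ys = Spine ` {Suc s..N}" "distinct ys" "length ys = N - s" "ys \<noteq> []"
    "last ys = Spine (Suc s)"
    using assms(2) by (auto simp: ys_def distinct_map inj_on_def last_rev hd_map simp del: upt_Suc)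
  have zs: "set zs = Spine ` {1..s} \<union> Tip True ` {1..<s}"
    using zigzag_properties(5)[of "s - 1"] assms(1)
    by (auto simp: zs_def atLeastLessThanSuc_atLeastAtMost[symmetric])
  have zs': "zs \<noteq> []" "hd zs = Spine 1" "length zs = 2 * (s - 1) + 1" "distinct zs"
    unfolding zs_def by (rule zigzag_properties)+
  show "path_in (tipped_verts N A) (tipped_edges N A) k ((!) xs)"
  proof (rule path_in_nth)
    show "distinct xs" using ys(2) zs'(4) by (auto simp: xs_def ys(1) zs)
    show "k \<le> length xs" using assms by (simp add: xs_def ys(3) zs'(3))
    have "Tip True i \<in> tipped_verts N A" if "1 \<le> i" "i < s" for i
      using that assms(3) by (intro tipped_vertsI) auto
    moreover have "Spine i \<in> tipped_verts N A" if "i \<le> N" for i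
      using that by (rule tipped_vertsI)
    ultimately show "set xs \<subseteq> tipped_verts N A"
      using assms(2) by (auto simp: xs_def ys(1) zs tipped_vertsI(1))
    have "successively (\<lambda>x y. {x, y} \<in> tipped_edges N A) ys"
      using spine_path[of "Suc N" N A "Suc s"] unfolding ys_def successively_rev
      by (simp add: insert_commute del: upt_Suc)
    moreover have "successively (\<lambda>x y. {x, y} \<in> tipped_edges N A) zs"
      unfolding zs_def
    proof (rule zigzag_path)
      have "(True, i) \<in> A" if "1 \<le> i" "i \<le> s - 1" for i
        using that by (intro subsetD[OF assms(3)]) auto
      then show "{True} \<times> {1..s - 1} \<subseteq> A" by auto
    qed (use assms(2) in simp)
    ultimately show "successively (\<lambda>x y. {x, y} \<in> tipped_edges N A) xs"
      using assms(1,2) zs'(1,2) 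
      by (simp add: xs_def successively_append_iff successively_Cons ys(5) tipped_edgesI(2,3))
  qed
qed

section \<open>Counting colours and the resulting lower bounds\<close>

lemma card_star_colours_ge:
  assumes "finite A"
  shows "3 * N + 3 + card A \<le>
    card ((\<lambda>e. if e \<inter> range tip = {} then e else e \<inter> range tip) ` tipped_edges N A)"
    (is "_ \<le> card (?c ` _)")
proof -
  \<comment> \<open>Every fan edge is its own colour and every tip adds one singleton colour; these
    differ because no fan edge contains a tip.\<close>
  let ?S = "(\<lambda>x. {tip x}) ` A"
  have "card ?S = card A"
    using inj_tip by (intro card_image) (auto simp: inj_on_def dest: injD)
  moreover have "fan_edges N \<inter> ?S = {}"
    using fan_edges_subset[of N] tip_notin_fan by blast
  ultimately have "3 * N + 3 + card A = card (fan_edges N \<union> ?S)"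
    using assms finite_fan(2) by (simp add: card_Un_disjoint card_fan_edges)
  also have "\<dots> \<le> card (?c ` tipped_edges N A)"
  proof (rule card_mono)
    show "finite (?c ` tipped_edges N A)" using finite_tipped(2)[OF assms] by simp
    have "?c e = e" if "e \<in> fan_edges N" for e
    proof -
      have "e \<inter> range tip = {}" using that fan_edges_subset[of N] tip_notin_fan by blast
      then show ?thesis by simp
    qed
    then have "e \<in> ?c ` tipped_edges N A" if "e \<in> fan_edges N" for e
      using that by (intro image_eqI[of _ _ e]) (simp_all add: tipped_edges_def)
    moreover have "{tip x} \<in> ?c ` tipped_edges N A" if x: "x \<in> A" for x
    proof (rule image_eqI)
      show "{tip x, Hub (fst x)} \<in> tipped_edges N A"
        unfolding tipped_edges_def using x
        by (intro UnI2 UN_I[of x]) (auto simp: tip_edges_def tip_def split: prod.split)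
      have "Hub (fst x) \<notin> range tip" by (auto simp: tip_def)
      then show "{tip x} = ?c {tip x, Hub (fst x)}" by simp
    qed
    ultimately show "fan_edges N \<union> ?S \<subseteq> ?c ` tipped_edges N A" by blast
  qed
  finally show ?thesis .
qed

text \<open>The \<open>r\<close> tips all sit at \<open>Hub True\<close>, which has \<open>N\<close>
  faces for them; \<open>n + 9 \<le> 2 * k\<close> says that \<open>r \<le> N\<close>, and
  \<open>k \<le> n\<close> gives the three tips that the path needs.\<close>

lemma planar_anti_ramsey_path_ge_small:
  assumes "10 \<le> k" "k \<le> n" "n + 9 \<le> 2 * k"
  shows "n + 2 * k - 12 \<le> planar_anti_ramsey n (path_graph k)"
proof -
  \<comment> \<open>\<open>N\<close> is chosen so that the \<open>N + 3\<close> vertices that are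
    not tips number \<open>k - 3\<close>, the most the star colouring allows; \<open>r\<close>
    brings the total to \<open>n\<close>.\<close>
  define N r A where "N = k - 6" and "r = n + 3 - k" and "A = {True} \<times> {..<r}"
  have A: "finite A" "A \<subseteq> UNIV \<times> {..<N}" "card A = r"
    using assms by (auto simp: A_def N_def r_def)
  have card_V: "card (tipped_verts N A) = n"
    using card_tipped_verts[OF A(1)] A(3) assms by (simp add: N_def r_def)
  obtain g where path: "path_in (tipped_verts N A) (tipped_edges N A) k g"
  proof -
    have "4 \<le> N" "{True} \<times> {..<3} \<subseteq> A" "N + 6 = k"
      using assms by (auto simp: N_def A_def r_def)
    then show ?thesis using short_path that by metis
  qed
  let ?c = "\<lambda>e. if e \<inter> range tip = {} then e else e \<inter> range tip"
  have "\<not> inj_on (\<lambda>i. ?c {h i, h (Suc i)}) {i. Suc i < k}"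
    if h: "path_in (tipped_verts N A) (tipped_edges N A) k h" for h
  proof -
    have "tipped_verts N A - range tip \<subseteq> fan_verts N" by (auto simp: tipped_verts_def)
    then have "card (tipped_verts N A - range tip) \<le> N + 3"
      using card_mono[OF finite_fan(1)] card_fan_verts by metis
    then have "card (tipped_verts N A - range tip) + 3 \<le> k" using assms by (simp add: N_def)
    from star_colouring_not_rainbow[OF h finite_tipped(1)[OF A(1)] this tips_independent]
    show ?thesis unfolding Let_def .
  qed
  from planar_anti_ramsey_ge[where c = ?c, OF conjunct1[OF realizable_tipped[OF A(1,2)]] path this,
      unfolded card_V]
  have "card (?c ` tipped_edges N A) \<le> planar_anti_ramsey n (path_graph k)"
    .
  moreover have "3 * N + 3 + r = n + 2 * k - 12" using assms by (simp add: N_def r_def)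
  ultimately show ?thesis using card_star_colours_ge[OF A(1), of N] A(3) by linarith
qed

text \<open>A tip edge has an end at a hub or at a spine vertex with index from \<open>1\<close> to
  \<open>s\<close>, because the tips sit over spine edges inside the core. Thus only spine edges
  beyond \<open>Spine s\<close> can miss the core.\<close>

lemma core_meets_edge:
  assumes "e \<in> tipped_edges N (UNIV \<times> {1..<s})" "1 \<le> s"
    and "e \<notin> (\<lambda>i. {Spine i, Spine (Suc i)}) ` {Suc s..<N}"
  shows "e \<inter> ({Hub True, Hub False} \<union> Spine ` {1..s}) \<noteq> {}" (is "_ \<inter> ?C \<noteq> _")
proof -
  consider b i where "e \<in> tip_edges (b, i)" "1 \<le> i" "i < s" | "Hub True \<in> e" | "Hub False \<in> e"
    | i where "e = {Spine i, Spine (Suc i)}" "i < N"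
    using assms(1) by (auto simp: tipped_edges_def fan_edges_def)
  then show ?thesis
  proof cases
    case (1 b i)
    have "Hub b \<in> ?C" by (cases b) simp_all
    moreover have "Spine i \<in> ?C" "Spine (Suc i) \<in> ?C" using 1 by auto
    moreover have "Hub b \<in> e \<or> Spine i \<in> e \<or> Spine (Suc i) \<in> e"
      using 1(1) by (auto simp: tip_edges_def)
    ultimately show ?thesis by blast
  next
    case (4 i)
    then have "\<not> Suc s \<le> i" using assms(3) by auto
    then have "Spine i \<in> ?C \<or> Spine (Suc i) \<in> ?C"
      \<comment> \<open>\<open>Spine 0\<close> is not in the core, but the edge at
        \<open>i = 0\<close> meets it in \<open>Spine 1\<close>.\<close>
      using assms(2) by (cases "i = 0") auto
    then show ?thesis using 4 by blast
  qed blast+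
qed

text \<open>Of the \<open>3 * N + 3 + 6 * (s - 1)\<close> edges, at most \<open>N - s - 1\<close>
  miss the core. The others keep distinct colours, and the shared colour adds one.\<close>

lemma card_core_colours_ge:
  assumes "1 \<le> s" "Suc s < N"
  shows "2 * N + 7 * s - 1 \<le> card ((\<lambda>e. if e \<inter> ({Hub True, Hub False} \<union> Spine ` {1..s}) = {} then {} else e) `
    tipped_edges N (UNIV \<times> {1..<s}))" (is "_ \<le> card (?c ` ?E)")
proof -
  let ?C = "{Hub True, Hub False} \<union> Spine ` {1..s}"
  define B where "B = (\<lambda>i. {Spine i, Spine (Suc i)}) ` {Suc s..<N}"
  have finE: "finite ?E" by (simp add: finite_tipped)
  have "card ?E = 3 * N + 3 + 6 * (s - 1)"
  proof -
    have "UNIV \<times> {1..<s} \<subseteq> UNIV \<times> {..<N}" using assms(2) by auto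
    from realizable_tipped[OF _ this] show ?thesis by (simp add: card_cartesian_product)
  qed
  moreover have "card B \<le> N - Suc s"
    unfolding B_def using card_image_le[of "{Suc s..<N}"] by fastforce
  moreover have "card ?E - card B \<le> card (?E - B)"
    by (rule diff_card_le_card_Diff) (simp add: B_def)
  ultimately have "2 * N + 7 * s - 1 \<le> card (?E - B) + 1" using assms by linarith
  have meets: "e \<inter> ?C \<noteq> {}" if "e \<in> ?E - B" for e
    using that assms(1) unfolding B_def by (intro core_meets_edge) blast+
  then have "{} \<notin> ?E - B" by blast
  then have "card (?E - B) + 1 = card (insert {} (?E - B))" using finE by simp
  also have "\<dots> \<le> card (?c ` ?E)"
  proof (rule card_mono)
    show "finite (?c ` ?E)" using finE by simp
    have "e \<in> ?c ` ?E" if "e \<in> ?E - B" for e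
    proof (rule image_eqI)
      show "e \<in> ?E" using that by blast
      show "e = ?c e" using meets[OF that] by (simp only: if_False)
    qed
    moreover have "{} \<in> ?c ` ?E"
    proof (rule image_eqI)
      \<comment> \<open>The shared colour counts only if it occurs; \<open>Suc s < N\<close>
        provides an edge missing the core.\<close>
      show "{Spine (Suc s), Spine (Suc (Suc s))} \<in> ?E" using assms(2) by (rule tipped_edgesI)
      have "{Spine (Suc s), Spine (Suc (Suc s))} \<inter> ?C = {}" by auto
      then show "{} = ?c {Spine (Suc s), Spine (Suc (Suc s))}" by simp
    qed
    ultimately show "insert {} (?E - B) \<subseteq> ?c ` ?E" by blast
  qed
  finally show ?thesis using \<open>2 * N + 7 * s - 1 \<le> card (?E - B) + 1\<close> by linarith
qed

text \<open>The core has at most \<open>s + 2\<close> vertices, so \<open>2 * s + 6 < k\<close>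
  excludes rainbow paths. The bound \<open>k + s \<le> n + 1\<close> makes the explicit path long
  enough, and \<open>3 * s + 3 \<le> n\<close> leaves a spine edge beyond the core.\<close>

lemma planar_anti_ramsey_path_ge_large:
  assumes "1 \<le> s" "2 * s + 6 < k" "k + s \<le> n + 1" "3 * s + 3 \<le> n"
  shows "2 * n + 3 * s - 3 \<le> planar_anti_ramsey n (path_graph k)"
proof -
  \<comment> \<open>The fan has \<open>N + 3\<close> vertices and there are
    \<open>2 * (s - 1)\<close> tips, which determines \<open>N\<close>.\<close>
  define N and A :: "(bool \<times> nat) set" where "N = n - 2 * s - 1" and "A = UNIV \<times> {1..<s}"
  have sN: "Suc s < N" using assms by (simp add: N_def)
  have A: "finite A" "A \<subseteq> UNIV \<times> {..<N}" "card A = 2 * (s - 1)"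
    using sN by (auto simp: A_def card_cartesian_product)
  let ?C = "{Hub True, Hub False} \<union> Spine ` {1..s}"
  let ?c = "\<lambda>e. if e \<inter> ?C = {} then {} else e"
  have card_V: "card (tipped_verts N A) = n"
    using card_tipped_verts[OF A(1)] A(3) assms by (simp add: N_def)
  obtain g where path: "path_in (tipped_verts N A) (tipped_edges N A) k g"
  proof -
    have "s < N" "{True} \<times> {1..<s} \<subseteq> A" "k \<le> N + s + 2"
      using sN assms by (auto simp: N_def A_def)
    then show ?thesis using long_path[OF assms(1)] that by metis
  qed
  have "card ?C \<le> card {Hub True, Hub False} + card (Spine ` {1..s})" by (rule card_Un_le)
  then have C: "finite ?C" "2 * card ?C + 2 < k"
    using card_image_le[of "{1..s}" Spine] assms(2) by simp_all
  have "\<not> inj_on (\<lambda>i. ?c {h i, h (Suc i)}) {i. Suc i < k}"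
    if "path_in (tipped_verts N A) (tipped_edges N A) k h" for h
    using core_colouring_not_rainbow[OF that C] unfolding Let_def .
  from planar_anti_ramsey_ge[where c = ?c, OF conjunct1[OF realizable_tipped[OF A(1,2)]] path this,
      unfolded card_V]
  have "card (?c ` tipped_edges N A) \<le> planar_anti_ramsey n (path_graph k)"
    .
  moreover have "2 * N + 7 * s - 1 = 2 * n + 3 * s - 3" using assms by (simp add: N_def)
  ultimately show ?thesis using card_core_colours_ge[OF assms(1) sN] by (simp add: A_def)
qed

theorem theorem2p3:
  fixes k n \<epsilon> :: nat
  assumes "10 \<le> k" and "k \<le> n" and "\<epsilon> = k mod 2"
  shows "(k \<le> n \<and> int n < 3 * int (k div 2) + int \<epsilon> - 5 \<longrightarrow>
            real (planar_anti_ramsey n (path_graph k)) \<ge> real n + 2 * real k - 12) \<and>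
         (3 * int (k div 2) + int \<epsilon> - 5 \<le> int n \<and> int n \<le> 5 * int (k div 2) + int \<epsilon> - 15 \<longrightarrow>
            real (planar_anti_ramsey n (path_graph k)) \<ge>
              (3 * real n + 9 * real (k div 2) + 3 * real \<epsilon> - 43) / 2) \<and>
         (int n > 5 * int (k div 2) + int \<epsilon> - 15 \<longrightarrow>
            real (planar_anti_ramsey n (path_graph k)) \<ge> 2 * real n + real k - 14)"
proof -
  define t where "t = k div 2"
  define M where "M = planar_anti_ramsey n (path_graph k)"
  have k: "k = 2 * t + \<epsilon>" "\<epsilon> \<le> 1" using assms(3) by (auto simp: t_def)
  then have t: "5 \<le> t" using assms(1) by linarith
  have small: "n + 2 * k - 12 \<le> M" if "int n < 3 * int t + int \<epsilon> - 5"
    unfolding M_def using that k t assms(1,2) by (intro planar_anti_ramsey_path_ge_small) linarith+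
  \<comment> \<open>With \<open>s = t - 4\<close> one has \<open>2 * s + 6 = 2 * t - 2 < k\<close>,
    and \<open>k + s \<le> n + 1\<close> becomes exactly the stated threshold on
    \<open>n\<close>.\<close>
  have large: "2 * n + 3 * (t - 4) - 3 \<le> M" if "3 * int t + int \<epsilon> - 5 \<le> int n"
    unfolding M_def using that k t by (intro planar_anti_ramsey_path_ge_large) linarith+
  have large': "2 * real n + 3 * real t - 15 \<le> real M" if "3 * int t + int \<epsilon> - 5 \<le> int n"
    using large[OF that] t by linarith
  show ?thesis
    unfolding t_def[symmetric] M_def[symmetric]
  proof (intro conjI impI; (elim conjE)?)
    assume "int n < 3 * int t + int \<epsilon> - 5"
    from small[OF this] show "real n + 2 * real k - 12 \<le> real M" using assms(1) by linarith
  next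
    assume n: "3 * int t + int \<epsilon> - 5 \<le> int n"
    \<comment> \<open>The bound \<open>2 * n + 3 * t - 15\<close> dominates the claimed one once
      \<open>n \<ge> 3 * t + 3 * \<epsilon> - 13\<close>, which follows from the threshold and
      \<open>\<epsilon> \<le> 1\<close>.\<close>
    have "3 * t + \<epsilon> \<le> n + 5" using n by linarith
    then have "3 * real t + real \<epsilon> \<le> real n + 5" by linarith
    moreover have "real \<epsilon> \<le> 1" using k by simp
    ultimately show "(3 * real n + 9 * real t + 3 * real \<epsilon> - 43) / 2 \<le> real M"
      using large'[OF n] by (simp add: field_simps)
  next
    assume "5 * int t + int \<epsilon> - 15 < int n"
    \<comment> \<open>As \<open>t \<ge> 5\<close>, the last range lies above the same threshold, and
      \<open>3 * t - 15 \<ge> k - 14\<close>.\<close>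
    then have "3 * int t + int \<epsilon> - 5 \<le> int n" using t by linarith
    from large'[OF this] show "2 * real n + real k - 14 \<le> real M" using k t by linarith
  qed
qed

end
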